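(* Let $m>1$ be an integer, let $\ell$ be an odd integer, and let $K$ be the finite $2$-group with generators $a,b$ defined in the context. For any $x,y\in Z_2(K)$, the assignment $a\mapsto ax$, $b\mapsto by$ extends to a 2-central automorphism $\Gamma_{(x,y)}$ of $K$ that fixes $Z_1(K)$ and $Z_2(K)/Z_1(K)$ pointwise. Thus, $|\mathrm{Aut}_2(K)|=2^{6m-2}$ and the map $g:Z_2(K)\times Z_2(K)\to\mathrm{Aut}_2(K)/\mathrm{Aut}_1(K)$, given by $(x,y)\mapsto\Gamma_{(x,y)}\mathrm{Aut}_1(K)$, is a group epimorphism with kernel $Z_1(K)^2$, so that $\mathrm{Aut}_2(K)/\mathrm{Aut}_1(K)\cong(Z_2(K)/Z_1(K))^2$.
   Context: Notation: $[a,b]=a^{-1}b^{-1}ab$, $b^a=a^{-1}ba$, $\alpha=1+2^m\ell$. Let $$J=\langle A,B\mid A^{[A,B]}=A^{\alpha},\ B^{[B,A]}=B^{\alpha},\ A^{2^{3m-1}}=B^{2^{3m-1}}=1\rangle$$ and $K=J/Z_2(J)$, which has the presentation $$K=\langle a,b\mid a^{[a,b]}=a^{\alpha},\ b^{[b,a]}=b^{\alpha},\ a^{2^{2m-1}}=b^{2^{2m-1}}=[a,b]^{2^{m-1}}=1\rangle.$$ For a group $T$, $Z_0(T)=1, Z_1(T),Z_2(T),\dots$ denotes the upper central series, $T^n$ denotes the direct product of $n$ copies of $T$, and $\mathrm{Aut}_i(T)$ is the kernel of the canonical map $\mathrm{Aut}(T)\to\mathrm{Aut}(T/Z_i(T))$.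 An automorphism of $T$ is $i$-central if it belongs to $\mathrm{Aut}_i(T)$. *)

theory Defs
  imports "HOL-Algebra.Algebra"
begin

section \<open>Group presentations\<close>

text \<open>A word over generators of type \<open>'g\<close> is a list of letters; the letter \<open>(g, False)\<close>
  stands for \<open>g\<close> and \<open>(g, True)\<close> for the formal inverse of \<open>g\<close>.\<close>

type_synonym 'g word = "('g \<times> bool) list"

definition winv :: "'g word \<Rightarrow> 'g word" where
  "winv w = rev (map (\<lambda>(g, s). (g, \<not> s)) w)"

definition wpow :: "'g word \<Rightarrow> int \<Rightarrow> 'g word" where
  "wpow w k = concat (replicate (nat \<bar>k\<bar>) (if k \<ge> 0 then w else winv w))"

text \<open>The conventions are \<open>[u,v] = u\<inverse>v\<inverse>uv\<close> and \<open>u\<^sup>v = v\<inverse>uv\<close>.\<close>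

definition wcomm :: "'g word \<Rightarrow> 'g word \<Rightarrow> 'g word" where
  "wcomm u v = winv u @ winv v @ u @ v"

definition wconj :: "'g word \<Rightarrow> 'g word \<Rightarrow> 'g word" where
  "wconj u v = winv v @ u @ v"

text \<open>The congruence on words generated by free cancellation and the relations \<open>u = v\<close> for
  \<open>(u, v) \<in> R\<close>; its classes are the elements of the group presented by \<open>R\<close>.\<close>

inductive pres_cong :: "('g word \<times> 'g word) set \<Rightarrow> 'g word \<Rightarrow> 'g word \<Rightarrow> bool" for R where
  rel: "(u, v) \<in> R \<Longrightarrow> pres_cong R u v"
| cancel: "pres_cong R [(g, s), (g, \<not> s)] []"
| refl: "pres_cong R u u"
| sym: "pres_cong R u v \<Longrightarrow> pres_cong R v u"
| trans: "pres_cong R u v \<Longrightarrow> pres_cong R v w \<Longrightarrow> pres_cong R u w"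
| ctxt: "pres_cong R u v \<Longrightarrow> pres_cong R (p @ u @ q) (p @ v @ q)"

primrec weval :: "('a, 'b) monoid_scheme \<Rightarrow> ('g \<Rightarrow> 'a) \<Rightarrow> 'g word \<Rightarrow> 'a" where
  "weval G f [] = \<one>\<^bsub>G\<^esub>"
| "weval G f (x # w) =
     (if snd x then inv\<^bsub>G\<^esub> (f (fst x)) else f (fst x)) \<otimes>\<^bsub>G\<^esub> weval G f w"

text \<open>\<open>G\<close> is presented by the generators \<open>f g\<close> (\<open>g :: 'g\<close>) and the relations \<open>R\<close>: evaluation of
  words is onto \<open>G\<close>, and two words have the same value exactly if the relations force it. In other
  words, \<open>f\<close> induces an isomorphism from the group presented by \<open>R\<close> onto \<open>G\<close>.\<close>

definition has_presentation ::
  "('a, 'b) monoid_scheme \<Rightarrow> ('g \<Rightarrow> 'a) \<Rightarrow> ('g word \<times> 'g word) set \<Rightarrow> bool" where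
  "has_presentation G f R \<longleftrightarrow>
     group G \<and> range f \<subseteq> carrier G \<and> generate G (range f) = carrier G \<and>
     (\<forall>u v. weval G f u = weval G f v \<longleftrightarrow> pres_cong R u v)"

section \<open>The presentation of K\<close>

datatype gen = GenA | GenB

definition K_relations :: "nat \<Rightarrow> int \<Rightarrow> (gen word \<times> gen word) set" where
  "K_relations m l =
    (let a = [(GenA, False)]; b = [(GenB, False)]; \<alpha> = 1 + 2 ^ m * l in
      {(wconj a (wcomm a b), wpow a \<alpha>),
       (wconj b (wcomm b a), wpow b \<alpha>),
       (wpow a (2 ^ (2 * m - 1)), []),
       (wpow b (2 ^ (2 * m - 1)), []),
       (wpow (wcomm a b) (2 ^ (m - 1)), [])})"

text \<open>\<open>K\<close> arises as \<open>J/Z\<^sub>2(J)\<close>, where \<open>J\<close> is generated by \<open>A\<close>, \<open>B\<close> subject to the first two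
  relations and \<open>A^(2^(3m-1)) = B^(2^(3m-1)) = 1\<close>. The presentation of this quotient in terms of the
  cosets \<open>a\<close>, \<open>b\<close> of \<open>A\<close>, \<open>B\<close> determines it up to isomorphism and is taken as the definition.\<close>

definition is_K :: "nat \<Rightarrow> int \<Rightarrow> ('a, 'b) monoid_scheme \<Rightarrow> 'a \<Rightarrow> 'a \<Rightarrow> bool" where
  "is_K m l K a b \<longleftrightarrow> has_presentation K (case_gen a b) (K_relations m l)"

section \<open>Upper central series and central automorphisms\<close>

definition center :: "('a, 'b) monoid_scheme \<Rightarrow> 'a set" where
  "center G = {z \<in> carrier G. \<forall>x \<in> carrier G. z \<otimes>\<^bsub>G\<^esub> x = x \<otimes>\<^bsub>G\<^esub> z}"

primrec upper_central :: "('a, 'b) monoid_scheme \<Rightarrow> nat \<Rightarrow> 'a set" where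
  "upper_central G 0 = {\<one>\<^bsub>G\<^esub>}"
| "upper_central G (Suc i) =
     {x \<in> carrier G. upper_central G i #>\<^bsub>G\<^esub> x \<in> center (G Mod upper_central G i)}"

text \<open>The canonical map \<open>Aut(G) \<rightarrow> Aut(G/N)\<close> for a characteristic subgroup \<open>N\<close>: since an
  automorphism \<open>\<phi>\<close> maps the coset \<open>Nx\<close> onto \<open>N\<phi>(x)\<close>, the induced map sends a coset to its image
  under \<open>\<phi>\<close>. It is extensional, as required of the elements of \<open>AutoGroup\<close>.\<close>

definition induced_aut ::
  "('a, 'b) monoid_scheme \<Rightarrow> 'a set \<Rightarrow> ('a \<Rightarrow> 'a) \<Rightarrow> 'a set \<Rightarrow> 'a set" where
  "induced_aut G N \<phi> = (\<lambda>C \<in> carrier (G Mod N). \<phi> ` C)"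

definition central_auts :: "nat \<Rightarrow> ('a, 'b) monoid_scheme \<Rightarrow> ('a \<Rightarrow> 'a) set" where
  "central_auts i G =
     kernel (AutoGroup G) (AutoGroup (G Mod upper_central G i))
       (induced_aut G (upper_central G i))"

end

theory Submission
  imports Defs "HOL-Number_Theory.Cong"
begin

text \<open>
  Write \<open>c = [a, b]\<close>, \<open>h = 2\<^sup>m\<^sup>-\<^sup>1\<close>, \<open>N = 2\<^sup>m l\<close> and \<open>M = 2\<^sup>2\<^sup>m\<^sup>-\<^sup>1\<close>, so that \<open>M = 2h\<^sup>2\<close> and the relations read
  \<open>c\<inverse>ac = a\<^sup>1\<^sup>+\<^sup>N\<close>, \<open>cbc\<inverse> = b\<^sup>1\<^sup>+\<^sup>N\<close>, with \<open>a\<close>, \<open>b\<close> of exponent \<open>M\<close> and \<open>c\<close> of exponent \<open>h\<close>. They are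
  symmetric under \<open>a \<leftrightarrow> b\<close>, \<open>c \<leftrightarrow> c\<inverse>\<close> (\<open>swap\<close>), which halves the work.

  The structure of \<open>K\<close>. From \<open>b\<inverse>ab = ac\<close> and \<open>(ac)\<^sup>2\<^sup>h = a\<^sup>2\<^sup>h\<close> it follows that \<open>a\<^sup>2\<^sup>h\<close>, and likewise
  \<open>b\<^sup>2\<^sup>h\<close>, is central. Modulo the subgroup \<open>Z\<close> that they generate, \<open>c\<close> is central as well, so that
  \<open>K/Z\<close> multiplies like a Heisenberg group in the normal form \<open>a\<^sup>i b\<^sup>j c\<^sup>k\<close> (\<open>nf_mult\<close>), and every
  element of \<open>K\<close> has such a form. That the form is unique up to the exponents of \<open>a\<close>, \<open>b\<close>, \<open>c\<close>
  is the only place where one has to exclude that the relations have further consequences: it needs a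
  model. The permutations \<open>x \<mapsto> x + 1\<close> and \<open>x \<mapsto> x + N x(x + 1)/2\<close> of \<open>\<int>/M\<close> satisfy the relations, and together
  with the symmetry they separate all normal forms (\<open>nf_word_trivial\<close>). They also tell which normal forms
  are central (\<open>nf_word_central\<close>). Hence the centre is \<open>Z\<close>, and the second centre \<open>W\<close> consists of the
  normal forms with \<open>h\<close> dividing \<open>i\<close> and \<open>j\<close>; it has \<open>2\<^sup>3\<^sup>m\<^sup>-\<^sup>1\<close> elements.

  The automorphisms. \<open>Z\<close> has exponent \<open>h\<close>, and \<open>W\<close> is abelian of exponent \<open>2h\<close>, is centralised by \<open>c\<close> and has
  its \<open>h\<close>-th powers in \<open>Z\<close>. For \<open>x \<in> W\<close> the commutator \<open>w = [x, g]\<close> lies in \<open>Z\<close>, whence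
  \<open>(gx)\<^sup>n = g\<^sup>n x\<^sup>n w\<^sup>n\<^sup>(\<^sup>n\<^sup>-\<^sup>1\<^sup>)\<^sup>/\<^sup>2\<close> and therefore \<open>(gx)\<^sup>2\<^sup>h = g\<^sup>2\<^sup>h\<close>. So replacing \<open>a\<close>, \<open>b\<close> by \<open>ax\<close>, \<open>by\<close> multiplies \<open>c\<close> by
  an element of \<open>Z\<close>, and both sides of the relation \<open>c\<inverse>ac = a\<^sup>1\<^sup>+\<^sup>N\<close> acquire the factor \<open>x\<close>, those of the relation for \<open>b\<close>
  the factor \<open>y\<close>. The relations persist, and an endomorphism \<open>\<Gamma>(x, y)\<close> exists. The same power formula shows that it fixes \<open>Z\<close>
  pointwise and \<open>W\<close> modulo \<open>Z\<close>; being the identity modulo \<open>W\<close>, it is injective, hence an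
  automorphism of the finite group \<open>K\<close>. Conversely a 2-central automorphism moves \<open>a\<close> and \<open>b\<close> by
  elements of \<open>W\<close>, so \<open>\<Gamma>\<close> is a bijection of \<open>W \<times> W\<close> onto them.

  Finally \<open>\<theta>\<close>, sending \<open>\<Gamma>(x, y)\<close> to \<open>(Zx, Zy)\<close>, is a homomorphism because
  \<open>\<Gamma>(x, y)\<close> acts trivially on \<open>W/Z\<close>; it is onto with kernel the 1-central automorphisms. The
  isomorphism theorem applied to \<open>\<theta>\<close> gives the structure of the quotient, and comparing values of
  \<open>\<theta>\<close> shows that \<open>(x, y) \<mapsto> \<Gamma>(x, y)Aut\<^sub>1(K)\<close> is multiplicative.
\<close>

section \<open>Words and presentations\<close>

context group
begin

lemma weval_closed [simp, intro]:
  assumes "\<And>x. f x \<in> carrier G"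
  shows "weval G f w \<in> carrier G"
  by (induction w) (auto simp: assms)

lemma weval_append:
  assumes "\<And>x. f x \<in> carrier G"
  shows "weval G f (u @ v) = weval G f u \<otimes> weval G f v"
  by (induction u) (auto simp: assms m_assoc)

lemma weval_winv:
  assumes f: "\<And>x. f x \<in> carrier G"
  shows "weval G f (winv w) = inv (weval G f w)"
proof (induction w)
  case Nil
  then show ?case by (simp add: winv_def)
next
  case (Cons x w)
  have "winv (x # w) = winv w @ [(fst x, \<not> snd x)]"
    by (simp add: winv_def case_prod_beta)
  then show ?case
    using Cons by (simp add: weval_append f inv_mult_group)
qed

lemma weval_concat_replicate:
  assumes f: "\<And>x. f x \<in> carrier G"
  shows "weval G f (concat (replicate n w)) = weval G f w [^] n"
proof (induction n)
  case (Suc n)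
  then show ?case
    using nat_pow_Suc2[of "weval G f w" n] by (simp add: f weval_append)
qed simp

lemma weval_wpow:
  assumes f: "\<And>x. f x \<in> carrier G"
  shows "weval G f (wpow w k) = weval G f w [^] k"
proof (cases "k \<ge> 0")
  case True
  then have "wpow w k = concat (replicate (nat k) w)"
    unfolding wpow_def by simp
  then have "weval G f (wpow w k) = weval G f w [^] nat k"
    by (simp only: weval_concat_replicate[OF f])
  also have "\<dots> = weval G f w [^] k"
    using True by (rule pow_nat)
  finally show ?thesis .
next
  case False
  then have "wpow w k = concat (replicate (nat (- k)) (winv w))"
    unfolding wpow_def by simp
  then have "weval G f (wpow w k) = inv (weval G f w) [^] nat (- k)"
    by (simp only: weval_concat_replicate[OF f] weval_winv[OF f])
  also have "\<dots> = weval G f w [^] k"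
    unfolding int_pow_def2 using False nat_pow_inv[of "weval G f w" "nat (- k)"] f by simp
  finally show ?thesis .
qed

text \<open>Von Dyck: elements satisfying the relations satisfy all their consequences.\<close>

lemma weval_pres_cong:
  assumes f: "\<And>x. f x \<in> carrier G"
    and R: "\<And>u v. (u, v) \<in> R \<Longrightarrow> weval G f u = weval G f v"
    and "pres_cong R u v"
  shows "weval G f u = weval G f v"
  using assms(3)
proof induction
  case (cancel g s)
  then show ?case by (simp add: f)
qed (simp_all add: R f weval_append)

end

text \<open>The universal property: sending an element to the value of any word for it under \<open>f'\<close> is well
  defined, because two words for the same element are congruent.\<close>

lemma presentation_hom_exists:
  assumes K: "has_presentation K f R" and H: "group H"
    and f': "\<And>x. f' x \<in> carrier H"
    and R: "\<And>u v. (u, v) \<in> R \<Longrightarrow> weval H f' u = weval H f' v"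
  obtains \<phi> where "\<phi> \<in> hom K H" "\<And>x. \<phi> (f x) = f' x"
proof -
  interpret K: group K using K by (simp add: has_presentation_def)
  interpret H: group H by (rule H)
  have f: "f x \<in> carrier K" for x
    using K by (auto simp: has_presentation_def)
  define \<phi> where "\<phi> g = weval H f' (SOME w. weval K f w = g)" for g
  have eval: "\<phi> (weval K f w) = weval H f' w" for w
  proof -
    have "weval K f (SOME w'. weval K f w' = weval K f w) = weval K f w"
      by (rule someI) simp
    then have "pres_cong R (SOME w'. weval K f w' = weval K f w) w"
      using K by (simp add: has_presentation_def)
    then show ?thesis
      unfolding \<phi>_def using H.weval_pres_cong[of f' R, OF f' R] by blast
  qed
  have onto: "\<exists>w. g = weval K f w" if "g \<in> carrier K" for g
  proof -
    have "g \<in> generate K (range f)"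
      using that K by (simp add: has_presentation_def)
    then show ?thesis
    proof (induction rule: generate.induct)
      case one
      show ?case by (intro exI[of _ "[]"]) simp
    next
      case (incl h)
      then obtain x where "h = f x" by auto
      then show ?case by (intro exI[of _ "[(x, False)]"]) (simp add: f)
    next
      case (inv h)
      then obtain x where "h = f x" by auto
      then show ?case by (intro exI[of _ "[(x, True)]"]) (simp add: f)
    next
      case (eng h1 h2)
      then show ?case by (metis K.weval_append f)
    qed
  qed
  have "\<phi> \<in> hom K H"
  proof (rule homI)
    fix g h assume "g \<in> carrier K" "h \<in> carrier K"
    then obtain u v where uv: "g = weval K f u" "h = weval K f v"
      using onto by metis
    show "\<phi> g \<in> carrier H"
      unfolding uv eval by (simp add: f')
    have "\<phi> (weval K f u \<otimes>\<^bsub>K\<^esub> weval K f v) = \<phi> (weval K f (u @ v))"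
      by (simp add: K.weval_append f)
    then show "\<phi> (g \<otimes>\<^bsub>K\<^esub> h) = \<phi> g \<otimes>\<^bsub>H\<^esub> \<phi> h"
      unfolding uv eval by (simp add: H.weval_append f')
  qed
  moreover have "\<phi> (f x) = f' x" for x
    using eval[of "[(x, False)]"] by (simp add: f f')
  ultimately show thesis by (rule that)
qed

lemma homs_eq_on_generators:
  assumes "group G" "group H" "\<phi> \<in> hom G H" "\<psi> \<in> hom G H"
    and S: "S \<subseteq> carrier G" "generate G S = carrier G"
    and eq: "\<And>s. s \<in> S \<Longrightarrow> \<phi> s = \<psi> s"
    and g: "g \<in> carrier G"
  shows "\<phi> g = \<psi> g"
proof -
  interpret phi: group_hom G H \<phi>
    using assms by (simp add: group_hom_def group_hom_axioms_def)
  interpret psi: group_hom G H \<psi>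
    using assms by (simp add: group_hom_def group_hom_axioms_def)
  have "g \<in> generate G S" using g S by simp
  then have "\<phi> g = \<psi> g \<and> g \<in> carrier G"
    by (induction rule: generate.induct) (use S eq in auto)
  then show ?thesis by simp
qed

section \<open>Commutation in a group\<close>

context group
begin

lemma mult_inv_cancel:
  assumes "g \<in> carrier G" "x \<in> carrier G"
  shows "g \<otimes> (inv g \<otimes> x) = x" "inv g \<otimes> (g \<otimes> x) = x"
  using assms by (simp_all flip: m_assoc)

lemma int_pow_conj:
  assumes "g \<in> carrier G" "x \<in> carrier G"
  shows "inv g \<otimes> x [^] (k::int) \<otimes> g = (inv g \<otimes> x \<otimes> g) [^] k"
proof -
  have "(\<lambda>x. inv g \<otimes> x \<otimes> g) \<in> hom G G"
    by (rule homI) (use assms in \<open>simp_all add: m_assoc mult_inv_cancel\<close>)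
  then interpret conj: group_hom G G "\<lambda>x. inv g \<otimes> x \<otimes> g"
    by (simp add: group_hom_def group_hom_axioms_def is_group)
  show ?thesis using conj.hom_int_pow[OF assms(2)] by simp
qed

lemma conj_eq_iff:
  assumes "x \<in> carrier G" "y \<in> carrier G" "g \<in> carrier G"
  shows "inv g \<otimes> x \<otimes> g = y \<longleftrightarrow> x \<otimes> g = g \<otimes> y"
  using assms inv_solve_left[of y g "x \<otimes> g"] by (auto simp: m_assoc)

lemma commute_inv:
  assumes "x \<otimes> y = y \<otimes> x" "x \<in> carrier G" "y \<in> carrier G"
  shows "inv x \<otimes> y = y \<otimes> inv x"
proof -
  have "inv x \<otimes> y \<otimes> x = y"
    using assms by (simp add: conj_eq_iff)
  then show ?thesis
    using assms inv_solve_right[of "inv x \<otimes> y" y x] by auto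
qed

lemma int_pow_commute:
  assumes "x \<otimes> y = y \<otimes> x" "x \<in> carrier G" "y \<in> carrier G"
  shows "x [^] (i::int) \<otimes> y = y \<otimes> x [^] i"
proof -
  have "inv y \<otimes> x \<otimes> y = x"
    using assms by (simp add: conj_eq_iff)
  then have "inv y \<otimes> x [^] i \<otimes> y = x [^] i"
    using assms by (simp add: int_pow_conj)
  then show ?thesis
    using assms by (simp add: conj_eq_iff)
qed

lemma int_pow_commute2:
  assumes "x \<otimes> y = y \<otimes> x" "x \<in> carrier G" "y \<in> carrier G"
  shows "x [^] (i::int) \<otimes> y [^] (j::int) = y [^] j \<otimes> x [^] i"
  using assms int_pow_commute[of x y i] int_pow_commute[of y "x [^] i" j] by simp

text \<open>Conjugations by \<open>b\<close> and by \<open>a\<^sup>i\<close> are homomorphisms, so they commute with integer powers; this replaces an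
  induction on both exponents.\<close>

lemma commutator_int_pow:
  assumes G: "a \<in> carrier G" "b \<in> carrier G" "c \<in> carrier G"
    and ab: "a \<otimes> b = b \<otimes> a \<otimes> c"
    and ca: "c \<otimes> a = a \<otimes> c" and cb: "c \<otimes> b = b \<otimes> c"
  shows "a [^] (i::int) \<otimes> b [^] (j::int) = b [^] j \<otimes> a [^] i \<otimes> c [^] (i * j)"
proof -
  have "inv b \<otimes> a \<otimes> b = a \<otimes> c"
    using G ab by (simp add: m_assoc mult_inv_cancel)
  then have "inv b \<otimes> a [^] i \<otimes> b = a [^] i \<otimes> c [^] i"
    using G int_pow_mult_distrib[OF ca[symmetric]] by (simp add: int_pow_conj)
  then have 1: "a [^] i \<otimes> b = b \<otimes> (a [^] i \<otimes> c [^] i)"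
    using G by (simp add: conj_eq_iff)
  have ci: "c [^] i \<otimes> b = b \<otimes> c [^] i" "c [^] i \<otimes> a [^] i = a [^] i \<otimes> c [^] i"
    using int_pow_commute[OF cb] int_pow_commute2[OF ca] G by simp_all
  define A where "A = a [^] i"
  define C where "C = c [^] i"
  have AC: "A \<in> carrier G" "C \<in> carrier G" using G by (auto simp: A_def C_def)
  have 1: "A \<otimes> b = b \<otimes> (A \<otimes> C)" and C: "C \<otimes> b = b \<otimes> C" "C \<otimes> A = A \<otimes> C"
    using 1 ci by (simp_all add: A_def C_def)
  have "A \<otimes> b \<otimes> inv C = b \<otimes> A"
    using G AC 1 by (simp add: m_assoc)
  moreover have "inv C \<otimes> b = b \<otimes> inv C"
    using commute_inv[OF C(1)] G AC by simp
  ultimately have 2: "b \<otimes> A = A \<otimes> (b \<otimes> inv C)"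
    using G AC by (simp add: m_assoc)
  then have "inv A \<otimes> b \<otimes> A = b \<otimes> inv C"
    using conj_eq_iff[of b "b \<otimes> inv C" A] G AC by simp
  then have "inv A \<otimes> b [^] j \<otimes> A = b [^] j \<otimes> inv C [^] j"
    using G AC int_pow_mult_distrib[of b "inv C" j] \<open>inv C \<otimes> b = b \<otimes> inv C\<close>
    by (simp add: int_pow_conj)
  then have "b [^] j \<otimes> A = A \<otimes> (b [^] j \<otimes> inv C [^] j)"
    using G AC by (simp add: conj_eq_iff)
  then have "b [^] j \<otimes> A \<otimes> C [^] j = A \<otimes> b [^] j"
    using G AC by (simp add: m_assoc int_pow_inv)
  then show ?thesis
    using G by (simp add: A_def C_def int_pow_pow)
qed

text \<open>The collection formula in nilpotency class two: moving the \<open>u\<close>s to the left of the \<open>v\<close>s in \<open>(uv)\<^sup>n\<close>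
  passes \<open>n choose 2\<close> pairs.\<close>

lemma nat_pow_mult_commutator:
  assumes G: "u \<in> carrier G" "v \<in> carrier G" "w \<in> carrier G"
    and vu: "v \<otimes> u = u \<otimes> v \<otimes> w"
    and wu: "w \<otimes> u = u \<otimes> w" and wv: "w \<otimes> v = v \<otimes> w"
  shows "(u \<otimes> v) [^] n = u [^] n \<otimes> v [^] n \<otimes> w [^] (n choose 2)"
proof (induction n)
  case 0
  then show ?case by (simp add: numeral_2_eq_2)
next
  case (Suc n)
  have cl: "u [^] n \<in> carrier G" "v [^] n \<in> carrier G" "w [^] n \<in> carrier G"
    "w [^] (n choose 2) \<in> carrier G"
    using G by auto
  have 1: "v [^] n \<otimes> u = u \<otimes> v [^] n \<otimes> w [^] n"
    using commutator_int_pow[OF G(2,1,3) vu wv wu, of "int n" 1] G by (simp add: int_pow_int)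
  have 2: "w [^] k \<otimes> u = u \<otimes> w [^] k" "w [^] k \<otimes> v = v \<otimes> w [^] k" for k :: nat
    using group_commutes_pow[OF wu] group_commutes_pow[OF wv] G by simp_all
  have 2: "w [^] k \<otimes> (u \<otimes> v) = u \<otimes> v \<otimes> w [^] k" for k :: nat
    using 2[of k] G by (metis m_assoc nat_pow_closed)
  have 3: "w [^] k \<otimes> v = v \<otimes> w [^] k" for k :: nat
    using group_commutes_pow[OF wv] G by simp
  have "(u \<otimes> v) [^] Suc n = u [^] n \<otimes> v [^] n \<otimes> (w [^] (n choose 2) \<otimes> (u \<otimes> v))"
    using Suc G cl by (simp add: m_assoc)
  also have "\<dots> = u [^] n \<otimes> (v [^] n \<otimes> u) \<otimes> v \<otimes> w [^] (n choose 2)"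
    using G cl by (simp add: 2 m_assoc)
  also have "\<dots> = u [^] n \<otimes> u \<otimes> v [^] n \<otimes> (w [^] n \<otimes> v) \<otimes> w [^] (n choose 2)"
    using G cl by (simp add: 1 m_assoc)
  also have "\<dots> = (u [^] n \<otimes> u) \<otimes> (v [^] n \<otimes> v) \<otimes> (w [^] n \<otimes> w [^] (n choose 2))"
    using G cl by (simp add: 3 m_assoc)
  also have "w [^] n \<otimes> w [^] (n choose 2) = w [^] (Suc n choose 2)"
    using G by (simp add: nat_pow_mult numeral_2_eq_2)
  finally show ?case by simp
qed

lemma commute_mult:
  assumes "x \<otimes> u = u \<otimes> x" "x \<otimes> v = v \<otimes> x"
    and cl: "x \<in> carrier G" "u \<in> carrier G" "v \<in> carrier G"
  shows "x \<otimes> (u \<otimes> v) = u \<otimes> v \<otimes> x"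
proof -
  have "x \<otimes> (u \<otimes> v) = u \<otimes> x \<otimes> v"
    unfolding assms(1)[symmetric] using cl by (simp add: m_assoc)
  also have "\<dots> = u \<otimes> v \<otimes> x"
    using assms(2) cl by (simp add: m_assoc)
  finally show ?thesis .
qed

text \<open>Multiplication of normal forms in a Heisenberg group.\<close>

lemma class2_mult:
  assumes G: "a \<in> carrier G" "b \<in> carrier G" "c \<in> carrier G"
    and ab: "a \<otimes> b = b \<otimes> a \<otimes> c"
    and ca: "c \<otimes> a = a \<otimes> c" and cb: "c \<otimes> b = b \<otimes> c"
  shows "(a [^] (i::int) \<otimes> b [^] (j::int) \<otimes> c [^] (k::int)) \<otimes>
      (a [^] i' \<otimes> b [^] j' \<otimes> c [^] k') =
    a [^] (i + i') \<otimes> b [^] (j + j') \<otimes> c [^] (k + k' - j * i')"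
proof -
  define A where "A = a [^] i'"
  define B where "B = b [^] j"
  define B' where "B' = b [^] j'"
  define D where "D = c [^] k"
  define E where "E = c [^] (i' * j)"
  have cl: "A \<in> carrier G" "B \<in> carrier G" "B' \<in> carrier G" "D \<in> carrier G" "E \<in> carrier G"
    using G by (auto simp: A_def B_def B'_def D_def E_def)
  have DA: "D \<otimes> A = A \<otimes> D" and DB: "D \<otimes> B' = B' \<otimes> D" "E \<otimes> B' = B' \<otimes> E"
    unfolding A_def B'_def D_def E_def
    by (intro int_pow_commute2 ca cb G)+
  have "A \<otimes> B = B \<otimes> A \<otimes> E"
    unfolding A_def B_def E_def by (rule commutator_int_pow[OF G ab ca cb])
  then have BA: "B \<otimes> A = A \<otimes> B \<otimes> inv E"
    using cl by (simp add: m_assoc)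
  have EB: "inv E \<otimes> B' = B' \<otimes> inv E"
    using commute_inv[OF DB(2)] cl by simp
  have "(a [^] i \<otimes> B \<otimes> D) \<otimes> (A \<otimes> B' \<otimes> c [^] k') =
    a [^] i \<otimes> (B \<otimes> (D \<otimes> A)) \<otimes> (B' \<otimes> c [^] k')"
    using G cl by (simp add: m_assoc)
  also have "\<dots> = a [^] i \<otimes> (B \<otimes> A) \<otimes> (D \<otimes> B') \<otimes> c [^] k'"
    unfolding DA using G cl by (simp add: m_assoc)
  also have "\<dots> = a [^] i \<otimes> A \<otimes> B \<otimes> (inv E \<otimes> B') \<otimes> (D \<otimes> c [^] k')"
    unfolding BA DB(1) using G cl by (simp add: m_assoc)
  also have "\<dots> = (a [^] i \<otimes> A) \<otimes> (B \<otimes> B') \<otimes> (inv E \<otimes> (D \<otimes> c [^] k'))"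
    unfolding EB using G cl by (simp add: m_assoc)
  also have "a [^] i \<otimes> A = a [^] (i + i')"
    unfolding A_def by (simp add: G int_pow_mult)
  also have "B \<otimes> B' = b [^] (j + j')"
    unfolding B_def B'_def by (simp add: G int_pow_mult)
  also have "inv E = c [^] (- (i' * j))"
    unfolding E_def using G by (simp add: int_pow_neg)
  also have "c [^] (- (i' * j)) \<otimes> (D \<otimes> c [^] k') = c [^] (k + k' - j * i')"
    unfolding D_def by (simp add: G mult.commute flip: int_pow_mult)
  finally show ?thesis by (simp add: A_def B_def B'_def D_def)
qed

lemma int_pow_dvd_eq_one:
  assumes "x \<in> carrier G" "x [^] (n::int) = \<one>" "n dvd k"
  shows "x [^] k = \<one>"
  using assms int_pow_pow[of x n] by (auto elim!: dvdE)

end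

section \<open>The centre and the second centre of a group\<close>

context group
begin

lemma rcos_eq_iff:
  assumes "N \<lhd> G" "u \<in> carrier G" "v \<in> carrier G"
  shows "N #> u = N #> v \<longleftrightarrow> (\<exists>z\<in>N. u = z \<otimes> v)"
proof -
  interpret N: normal N G by (rule assms)
  show ?thesis
  proof
    assume "N #> u = N #> v"
    then have "u \<in> N #> v"
      using rcos_self[OF _ N.subgroup_axioms] assms by metis
    then show "\<exists>z\<in>N. u = z \<otimes> v"
      by (auto simp: r_coset_def)
  next
    assume "\<exists>z\<in>N. u = z \<otimes> v"
    then have "u \<in> N #> v" by (auto simp: r_coset_def)
    then show "N #> u = N #> v"
      using repr_independence[OF _ _ N.subgroup_axioms] assms by metis
  qed
qed

lemma rcos_eq_imp_inv_mult_mem: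
  assumes N: "N \<lhd> G" and "g \<in> carrier G" "g' \<in> carrier G" "N #> g' = N #> g"
  shows "inv g \<otimes> g' \<in> N"
proof -
  interpret N: normal N G by (rule N)
  obtain n where n: "n \<in> N" "g' = n \<otimes> g"
    using assms rcos_eq_iff[OF N, of g' g] by blast
  then have "inv g \<otimes> g' = inv g \<otimes> n \<otimes> g"
    using assms N.mem_carrier by (simp add: m_assoc)
  then show ?thesis
    using N.inv_op_closed1 n assms by simp
qed

text \<open>Centrality in a quotient in terms of elements: the form in which the upper central series is
  used below.\<close>

lemma rcos_in_center_FactGroup_iff:
  assumes "N \<lhd> G" "x \<in> carrier G"
  shows "N #> x \<in> center (G Mod N) \<longleftrightarrow>
    (\<forall>g\<in>carrier G. \<exists>z\<in>N. x \<otimes> g = z \<otimes> (g \<otimes> x))"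
proof -
  interpret N: normal N G by (rule assms)
  have "N #> x \<in> center (G Mod N) \<longleftrightarrow> (\<forall>g\<in>carrier G. N #> (x \<otimes> g) = N #> (g \<otimes> x))"
    using assms(2) by (auto simp: center_def carrier_FactGroup N.rcos_sum)
  also have "\<dots> \<longleftrightarrow> (\<forall>g\<in>carrier G. \<exists>z\<in>N. x \<otimes> g = z \<otimes> (g \<otimes> x))"
    using assms by (simp add: rcos_eq_iff)
  finally show ?thesis .
qed

lemma upper_central_1: "upper_central G (Suc 0) = center G"
proof -
  have "{\<one>} #> x \<in> center (G Mod {\<one>}) \<longleftrightarrow> (\<forall>g\<in>carrier G. x \<otimes> g = g \<otimes> x)"
    if "x \<in> carrier G" for x
    unfolding rcos_in_center_FactGroup_iff[OF one_is_normal that]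
    using that by (intro ball_cong) auto
  then show ?thesis
    unfolding center_def[of G] upper_central.simps by blast
qed

lemma center_commute:
  assumes "z \<in> center G" "x \<in> carrier G"
  shows "z \<otimes> x = x \<otimes> z"
  using assms unfolding center_def by blast

lemma center_closed [simp, intro]: "z \<in> center G \<Longrightarrow> z \<in> carrier G"
  unfolding center_def by blast

lemma centerI:
  assumes "z \<in> carrier G" "\<And>x. x \<in> carrier G \<Longrightarrow> z \<otimes> x = x \<otimes> z"
  shows "z \<in> center G"
  using assms unfolding center_def by blast

lemma center_normal: "center G \<lhd> G"
proof (rule normal_invI)
  show "subgroup (center G) G"
  proof (rule subgroupI)
    have "\<one> \<in> center G"
      by (rule centerI) simp_all
    then show "center G \<noteq> {}" by blast
    show "inv x \<in> center G" if "x \<in> center G" for x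
    proof (rule centerI)
      show "inv x \<otimes> g = g \<otimes> inv x" if "g \<in> carrier G" for g
        using commute_inv[OF center_commute] \<open>x \<in> center G\<close> that by blast
    qed (use that in simp)
    show "x \<otimes> y \<in> center G" if "x \<in> center G" "y \<in> center G" for x y
    proof (rule centerI)
      fix g assume "g \<in> carrier G"
      then show "x \<otimes> y \<otimes> g = g \<otimes> (x \<otimes> y)"
        using that center_commute[OF that(1), of g] center_commute[OF that(2), of g]
          m_assoc[of x y g] m_assoc[of x g y] m_assoc[of g x y] by simp
    qed (use that in simp)
  qed blast
  show "g \<otimes> z \<otimes> inv g \<in> center G" if "g \<in> carrier G" "z \<in> center G" for g z
  proof -
    have "g \<otimes> z \<otimes> inv g = z \<otimes> (g \<otimes> inv g)"
      unfolding center_commute[OF that(2,1), symmetric] using that by (simp only: m_assoc center_closed inv_closed)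
    then show ?thesis using that by simp
  qed
qed

lemma upper_central_2_iff:
  "x \<in> upper_central G 2 \<longleftrightarrow>
    x \<in> carrier G \<and> (\<forall>g\<in>carrier G. \<exists>z\<in>center G. x \<otimes> g = z \<otimes> (g \<otimes> x))"
proof -
  have "upper_central G 2 = {x \<in> carrier G. center G #> x \<in> center (G Mod center G)}"
    unfolding numeral_2_eq_2 upper_central.simps(2)[of G "Suc 0"] upper_central_1 ..
  then show ?thesis
    unfolding mem_Collect_eq
    using rcos_in_center_FactGroup_iff[OF center_normal, of x] by (simp only: mem_Collect_eq cong: conj_cong)
qed

lemma central_subgroup_normal:
  assumes H: "subgroup H G" and central: "H \<subseteq> center G"
  shows "H \<lhd> G"
proof (rule normal_invI[OF H])
  fix g z assume gz: "g \<in> carrier G" "z \<in> H"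
  then have z: "z \<in> center G" using central by blast
  have "g \<otimes> z \<otimes> inv g = z \<otimes> (g \<otimes> inv g)"
    unfolding center_commute[OF z gz(1), symmetric] using z gz by (simp only: m_assoc center_closed inv_closed)
  then show "g \<otimes> z \<otimes> inv g \<in> H" using gz z by simp
qed

lemma center_if_commutes_with_generators:
  assumes S: "S \<subseteq> carrier G" "generate G S = carrier G"
    and z: "z \<in> carrier G" and comm: "\<And>s. s \<in> S \<Longrightarrow> z \<otimes> s = s \<otimes> z"
  shows "z \<in> center G"
proof (rule centerI[OF z])
  fix x assume "x \<in> carrier G"
  then have "x \<in> generate G S" using S by simp
  then have "x \<in> carrier G \<and> x \<otimes> z = z \<otimes> x"
  proof (induction rule: generate.induct)
    case (inv s)
    then show ?case using S z comm commute_inv[of s z] by auto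
  next
    case (eng x y)
    then have cl: "x \<in> carrier G" "y \<in> carrier G" "x \<otimes> z = z \<otimes> x" "y \<otimes> z = z \<otimes> y" by auto
    have "x \<otimes> y \<otimes> z = x \<otimes> z \<otimes> y"
      using cl(1,2) z by (simp only: m_assoc cl(4))
    also have "\<dots> = z \<otimes> (x \<otimes> y)"
      unfolding cl(3) using cl(1,2) z by (simp only: m_assoc)
    finally show ?case using cl by simp
  qed (use S z comm in auto)
  then show "z \<otimes> x = x \<otimes> z" by simp
qed

text \<open>Commutators do not see central factors. Both products \<open>(uw)(vw')\<close> and \<open>(vw')(uw)\<close> acquire the same
  central factor \<open>t = ww'\<close>, which cancels.\<close>

lemma commutator_mult_central:
  assumes uv: "u \<in> carrier G" "v \<in> carrier G" and w: "w \<in> center G" "w' \<in> center G"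
  shows "inv (u \<otimes> w) \<otimes> inv (v \<otimes> w') \<otimes> (u \<otimes> w) \<otimes> (v \<otimes> w') = inv u \<otimes> inv v \<otimes> u \<otimes> v"
proof -
  define t where "t = w \<otimes> w'"
  have t: "t \<in> center G"
    unfolding t_def by (rule subgroup.m_closed[OF normal_imp_subgroup[OF center_normal] w])
  have cl: "w \<in> carrier G" "w' \<in> carrier G" "t \<in> carrier G"
    using w t by auto
  have "(u \<otimes> w) \<otimes> (v \<otimes> w') = u \<otimes> (w \<otimes> v) \<otimes> w'"
    using uv cl by (simp add: m_assoc)
  also have "\<dots> = u \<otimes> v \<otimes> t"
    unfolding center_commute[OF w(1) uv(2)] t_def using uv cl by (simp add: m_assoc)
  finally have 1: "(u \<otimes> w) \<otimes> (v \<otimes> w') = u \<otimes> v \<otimes> t" .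
  have "(v \<otimes> w') \<otimes> (u \<otimes> w) = v \<otimes> (w' \<otimes> u) \<otimes> w"
    using uv cl by (simp add: m_assoc)
  also have "\<dots> = v \<otimes> u \<otimes> (w' \<otimes> w)"
    unfolding center_commute[OF w(2) uv(1)] using uv cl by (simp add: m_assoc)
  also have "w' \<otimes> w = t"
    unfolding t_def using center_commute[OF w(2)] cl by simp
  finally have 2: "(v \<otimes> w') \<otimes> (u \<otimes> w) = v \<otimes> u \<otimes> t" .
  have "inv (u \<otimes> w) \<otimes> inv (v \<otimes> w') \<otimes> (u \<otimes> w) \<otimes> (v \<otimes> w') =
    inv ((v \<otimes> w') \<otimes> (u \<otimes> w)) \<otimes> ((u \<otimes> w) \<otimes> (v \<otimes> w'))"
    using uv cl by (simp add: m_assoc inv_mult_group)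
  also have "\<dots> = inv (v \<otimes> u \<otimes> t) \<otimes> (u \<otimes> v \<otimes> t)"
    by (simp only: 1 2)
  also have "\<dots> = inv (v \<otimes> u \<otimes> t) \<otimes> (t \<otimes> (u \<otimes> v))"
    using center_commute[OF t, of "u \<otimes> v"] uv by simp
  also have "v \<otimes> u \<otimes> t = t \<otimes> (v \<otimes> u)"
    using center_commute[OF t, of "v \<otimes> u"] uv by simp
  also have "inv (t \<otimes> (v \<otimes> u)) \<otimes> (t \<otimes> (u \<otimes> v)) = inv u \<otimes> inv v \<otimes> u \<otimes> v"
    using uv cl by (simp add: inv_mult_group m_assoc mult_inv_cancel)
  finally show ?thesis .
qed

end

lemma (in group_hom) rcos_kernel_eq_iff:
  assumes "u \<in> carrier G" "v \<in> carrier G"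
  shows "kernel G H h #> u = kernel G H h #> v \<longleftrightarrow> h u = h v"
proof -
  have "h u = h v \<longleftrightarrow> (\<exists>z\<in>kernel G H h. u = z \<otimes> v)"
  proof
    assume "h u = h v"
    then have "u \<otimes> inv v \<in> kernel G H h"
      using assms by (simp add: kernel_def)
    moreover have "u = (u \<otimes> inv v) \<otimes> v"
      using assms by (simp add: G.m_assoc)
    ultimately show "\<exists>z\<in>kernel G H h. u = z \<otimes> v" by blast
  qed (use assms in \<open>auto simp: kernel_def\<close>)
  then show ?thesis
    using G.rcos_eq_iff[OF normal_kernel] assms by simp
qed

section \<open>An action of K on the integers modulo a power of two\<close>

text \<open>The right action of \<open>K\<close> on the cosets of the subgroup generated by \<open>b\<close> and \<open>c\<close>, where the integer \<open>x\<close> modulo \<open>M\<close>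
  stands for the coset of \<open>a\<^sup>x\<close>: as \<open>b\<inverse>a\<^sup>xb = (ac)\<^sup>x\<close>, collecting the \<open>c\<close>s in \<open>(ac)\<^sup>x\<close> on the left gives
  \<open>x \<mapsto> x + N x(x + 1)/2\<close> for \<open>b\<close>, and \<open>c\<inverse>a\<^sup>xc = a\<^sup>(\<^sup>1\<^sup>+\<^sup>N\<^sup>)\<^sup>x\<close> gives multiplication by \<open>1 + N\<close> for \<open>c\<close>. Only the
  formulas are used: they are checked to respect the relations, so that words with equal
  values in \<open>K\<close> act in the same way.\<close>

definition tri :: "int \<Rightarrow> int" where
  "tri x = x * (x + 1) div 2"

lemma two_tri: "2 * tri x = x * (x + 1)"
  unfolding tri_def by simp

lemma tri_simps [simp]: "tri 0 = 0" "tri (-1) = 0" "tri 1 = 1"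
  by (simp_all add: tri_def)

lemma tri_diff: "tri x = tri (x - 1) + x"
  using two_tri[of x] two_tri[of "x - 1"] by (simp add: algebra_simps)

lemma tri_add_even: "tri (x + 2 * d) = tri x + d * (2 * x + 1 + 2 * d)"
  using two_tri[of x] two_tri[of "x + 2 * d"] by (simp add: algebra_simps)

text \<open>The maps act on all integers, but the two maps for \<open>b\<close> are inverse to each other only modulo \<open>M\<close>: the displacement,
  a multiple of \<open>2h\<close>, changes \<open>tri\<close> by a multiple of \<open>h\<close> (\<open>tri_cong\<close>).\<close>

fun act_letter :: "int \<Rightarrow> gen \<times> bool \<Rightarrow> int \<Rightarrow> int" where
  "act_letter N (GenA, s) x = (if s then x - 1 else x + 1)"
| "act_letter N (GenB, s) x = (if s then x - N * tri x else x + N * tri x)"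

definition act :: "int \<Rightarrow> gen word \<Rightarrow> int \<Rightarrow> int" where
  "act N w = fold (act_letter N) w"

lemma act_append: "act N (u @ v) x = act N v (act N u x)"
  by (simp add: act_def)

lemma act_Nil: "act N [] x = x"
  by (simp add: act_def)

lemma act_Cons: "act N (p # w) x = act N w (act_letter N p x)"
  by (simp add: act_def)

locale parameters =
  fixes m :: nat and l :: int
  assumes m: "m > 1" and l: "odd l"
begin

definition h :: int where "h = 2 ^ (m - 1)"
definition M :: int where "M = 2 * h * h"
definition N :: int where "N = 2 * h * l"

lemma h_pos: "h > 0"
  by (simp add: h_def)

lemma even_h: "even h"
  using m by (simp add: h_def)

lemma coprime_h_odd: "odd x \<Longrightarrow> coprime (2 * h) x"
  by (simp add: h_def)

lemma coprime_h_l: "coprime h l"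
  using l by (simp add: h_def)

lemma two_power_m: "(2::int) ^ m = 2 * h"
  using m by (simp add: h_def flip: power_Suc)

lemma two_power_2m1: "(2::int) ^ (2 * m - 1) = M"
proof -
  have "2 * m - 1 = Suc (m - 1 + (m - 1))"
    using m by simp
  then show ?thesis
    by (simp only: M_def h_def power_Suc power_add mult.assoc)
qed

lemma h_power: "(2::int) ^ (m - 1) = h"
  by (simp add: h_def)

lemma N_mult_cong:
  assumes "[x = y] (mod h)"
  shows "[N * x = N * y] (mod M)"
proof -
  from assms have "2 * h * h dvd 2 * h * (x - y)"
    by (simp add: cong_iff_dvd_diff)
  then have "2 * h * h dvd 2 * h * (x - y) * l"
    by simp
  then show ?thesis
    by (simp add: N_def M_def cong_iff_dvd_diff algebra_simps)
qed

lemma N_mult_cong_0_iff: "[N * x = 0] (mod M) \<longleftrightarrow> h dvd x"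
proof -
  have "[N * x = 0] (mod M) \<longleftrightarrow> h dvd l * x"
    using h_pos by (simp add: N_def M_def cong_0_iff mult.assoc)
  also have "\<dots> \<longleftrightarrow> h dvd x"
    using coprime_h_l by (simp add: coprime_dvd_mult_right_iff)
  finally show ?thesis .
qed

lemma N_N_cong_0: "[N * (N * x) = 0] (mod M)"
  unfolding N_mult_cong_0_iff by (simp add: N_def)

lemma cong_M_imp_cong_2h: "[x = y] (mod M) \<Longrightarrow> [x = y] (mod 2 * h)"
  by (auto simp: M_def cong_iff_dvd_diff intro: dvd_mult_left)

lemma cong_2h_imp_cong_h: "[x = y] (mod 2 * h) \<Longrightarrow> [x = y] (mod h)"
  by (auto simp: cong_iff_dvd_diff intro: dvd_mult_right)

lemma add_N_cong_2h: "[x + N * y = x] (mod 2 * h)"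
  by (simp add: cong_iff_dvd_diff N_def)

lemma tri_cong:
  assumes "[x = y] (mod 2 * h)"
  shows "[tri x = tri y] (mod h)"
proof -
  obtain d where "x - y = 2 * h * d"
    using assms by (auto simp: cong_iff_dvd_diff)
  then have "x = y + 2 * (h * d)" by simp
  then have "tri x - tri y = h * (d * (2 * y + 1 + 2 * (h * d)))"
    by (simp add: tri_add_even)
  then show ?thesis by (simp add: cong_iff_dvd_diff)
qed

text \<open>A displacement \<open>x \<mapsto> x + N \<phi>(x)\<close> is well defined modulo \<open>M\<close> and insensitive to earlier displacements of the same
  kind once \<open>\<phi>\<close> modulo \<open>h\<close> only depends on \<open>x\<close> modulo \<open>2h\<close>. Words acting by such maps
  compose by adding the functions \<open>\<phi>\<close>; this reduces all computations with \<open>b\<close> and \<open>c\<close> to additions.\<close>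

definition compat :: "(int \<Rightarrow> int) \<Rightarrow> bool" where
  "compat \<phi> \<longleftrightarrow> (\<forall>x y. [x = y] (mod 2 * h) \<longrightarrow> [\<phi> x = \<phi> y] (mod h))"

definition displaces :: "gen word \<Rightarrow> (int \<Rightarrow> int) \<Rightarrow> bool" where
  "displaces w \<phi> \<longleftrightarrow> compat \<phi> \<and> (\<forall>x. [act N w x = x + N * \<phi> x] (mod M))"

lemma act_letter_cong:
  assumes "[x = y] (mod M)"
  shows "[act_letter N p x = act_letter N p y] (mod M)"
proof -
  have "[N * tri x = N * tri y] (mod M)"
    using assms by (intro N_mult_cong tri_cong cong_M_imp_cong_2h)
  with assms show ?thesis
    by (cases p; cases "fst p") (auto intro: cong_add cong_diff)
qed

lemma act_cong:
  assumes "[x = y] (mod M)"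
  shows "[act N w x = act N w y] (mod M)"
  using assms
proof (induction w arbitrary: x y)
  case (Cons p w)
  then show ?case by (simp add: act_Cons act_letter_cong)
qed (simp add: act_Nil)

lemma act_letter_inverse:
  "[act_letter N (g, \<not> s) (act_letter N (g, s) x) = x] (mod M)"
proof -
  have "[N * tri (x + N * y) = N * tri x] (mod M)" for y
    by (intro N_mult_cong tri_cong add_N_cong_2h)
  from this[of "tri x"] this[of "- tri x"] show ?thesis
    by (cases g) (auto simp: cong_iff_dvd_diff dvd_minus_iff[symmetric, of _ "N * _ - _"] algebra_simps)
qed

lemma act_winv: "[act N w (act N (winv w) x) = x] (mod M)"
proof (induction w arbitrary: x)
  case Nil
  then show ?case by (simp add: winv_def act_Nil)
next
  case (Cons p w)
  obtain g s where p: "p = (g, s)" by (cases p)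
  have "act N (p # w) (act N (winv (p # w)) x) =
    act N w (act_letter N (g, s) (act_letter N (g, \<not> s) (act N (winv w) x)))"
    by (simp add: winv_def act_append act_Cons act_Nil p)
  also have "[act N w (act_letter N (g, s) (act_letter N (g, \<not> s) (act N (winv w) x))) =
    act N w (act N (winv w) x)] (mod M)"
    using act_letter_inverse[of g "\<not> s"] by (intro act_cong) simp
  also have "[act N w (act N (winv w) x) = x] (mod M)"
    by (rule Cons.IH)
  finally show ?case .
qed

lemma winv_winv: "winv (winv w) = w"
  by (induction w) (auto simp: winv_def)

lemma displaces_append:
  assumes "displaces u \<phi>" "displaces v \<psi>"
  shows "displaces (u @ v) (\<lambda>x. \<phi> x + \<psi> x)"
  unfolding displaces_def
proof (intro conjI allI)
  show "compat (\<lambda>x. \<phi> x + \<psi> x)"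
    using assms by (auto simp: displaces_def compat_def intro: cong_add)
  fix x
  have "[act N v (act N u x) = act N u x + N * \<psi> (act N u x)] (mod M)"
    using assms by (simp add: displaces_def)
  also have "[act N u x + N * \<psi> (act N u x) = (x + N * \<phi> x) + N * \<psi> x] (mod M)"
  proof (intro cong_add N_mult_cong)
    show u: "[act N u x = x + N * \<phi> x] (mod M)"
      using assms by (simp add: displaces_def)
    have "[act N u x = x] (mod 2 * h)"
      using cong_M_imp_cong_2h[OF u] add_N_cong_2h cong_trans by blast
    then show "[\<psi> (act N u x) = \<psi> x] (mod h)"
      using assms by (simp add: displaces_def compat_def)
  qed
  finally show "[act N (u @ v) x = x + N * (\<phi> x + \<psi> x)] (mod M)"
    by (simp add: act_append algebra_simps)
qed

lemma displaces_Nil: "displaces [] (\<lambda>x. 0)"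
  by (simp add: displaces_def compat_def act_Nil)

lemma displaces_winv:
  assumes "displaces w \<phi>"
  shows "displaces (winv w) (\<lambda>x. - \<phi> x)"
  unfolding displaces_def
proof (intro conjI allI)
  show "compat (\<lambda>x. - \<phi> x)"
    using assms by (auto simp: displaces_def compat_def cong_minus_minus_iff)
  fix x
  let ?y = "x + N * - \<phi> x"
  have "[act N w ?y = ?y + N * \<phi> ?y] (mod M)"
    using assms by (simp add: displaces_def)
  also have "[?y + N * \<phi> ?y = ?y + N * \<phi> x] (mod M)"
  proof (intro cong_add N_mult_cong cong_refl)
    show "[\<phi> ?y = \<phi> x] (mod h)"
      using assms add_N_cong_2h unfolding displaces_def compat_def by blast
  qed
  also have "?y + N * \<phi> x = x" by simp
  finally have "[act N (winv w) (act N w ?y) = act N (winv w) x] (mod M)"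
    by (rule act_cong)
  then show "[act N (winv w) x = ?y] (mod M)"
    using act_winv[of "winv w" ?y] unfolding winv_winv by (metis cong_sym cong_trans)
qed

lemma displaces_wpow:
  assumes "displaces w \<phi>"
  shows "displaces (wpow w k) (\<lambda>x. k * \<phi> x)"
proof -
  have nat: "displaces (concat (replicate n u)) (\<lambda>x. int n * \<psi> x)" if "displaces u \<psi>" for n u \<psi>
  proof (induction n)
    case 0
    show ?case using displaces_Nil by simp
  next
    case (Suc n)
    show ?case
      using displaces_append[OF that Suc] by (simp add: algebra_simps)
  qed
  show ?thesis
    using nat[OF assms, of "nat \<bar>k\<bar>"] nat[OF displaces_winv[OF assms], of "nat \<bar>k\<bar>"]
    by (cases "k \<ge> 0") (simp_all add: wpow_def)
qed

abbreviation wA :: "gen word" where "wA \<equiv> [(GenA, False)]"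
abbreviation wB :: "gen word" where "wB \<equiv> [(GenB, False)]"

lemma act_wpow_A: "act N (wpow wA i) x = x + i"
proof -
  have "act N (concat (replicate n wA)) x = x + int n"
    "act N (concat (replicate n (winv wA))) x = x - int n" for n x
    by (induction n arbitrary: x) (simp_all add: act_Nil act_Cons winv_def)
  then show ?thesis by (simp add: wpow_def)
qed

lemma displaces_B: "displaces wB tri"
  by (simp add: displaces_def compat_def tri_cong act_Cons act_Nil)

lemma compat_id: "compat (\<lambda>x. x)"
  by (simp add: compat_def cong_2h_imp_cong_h)

text \<open>That \<open>c\<close> multiplies by \<open>1 + N\<close> is the identity \<open>tri x - tri (x - 1) = x\<close>.\<close>

lemma displaces_comm: "displaces (wcomm wA wB) (\<lambda>x. x)"
  unfolding displaces_def
proof (intro conjI allI compat_id)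
  fix x
  let ?y = "x + N * - tri (x - 1)"
  have "act N (wcomm wA wB) x = ?y + N * tri ?y"
    by (simp add: wcomm_def winv_def act_Cons act_Nil)
  also have "[?y + N * tri ?y = ?y + N * tri x] (mod M)"
    by (intro cong_add N_mult_cong cong_refl tri_cong add_N_cong_2h)
  also have "?y + N * tri x = x + N * x"
    using tri_diff[of x] by (simp add: algebra_simps)
  finally show "[act N (wcomm wA wB) x = x + N * x] (mod M)" .
qed

lemma displaces_comm_BA: "displaces (wcomm wB wA) (\<lambda>x. - x)"
  using displaces_winv[OF displaces_comm] by (simp add: wcomm_def winv_def)

lemma displaces_imp_act_cong:
  assumes "displaces u \<phi>" "displaces v \<psi>" "\<And>x. [\<phi> x = \<psi> x] (mod h)"
  shows "[act N u x = act N v x] (mod M)"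
proof -
  have "[act N u x = x + N * \<phi> x] (mod M)" "[act N v x = x + N * \<psi> x] (mod M)"
    using assms by (simp_all add: displaces_def)
  moreover have "[x + N * \<phi> x = x + N * \<psi> x] (mod M)"
    by (intro cong_add cong_refl N_mult_cong assms)
  ultimately show ?thesis by (meson cong_sym cong_trans)
qed

lemma act_conj_A: "[act N (wconj wA (wcomm wA wB)) x = x + (1 + N)] (mod M)"
proof -
  let ?c = "wcomm wA wB"
  let ?y = "act N (winv ?c) x + 1"
  have "act N (wconj wA ?c) x = act N ?c ?y"
    by (simp add: wconj_def act_append act_Cons act_Nil)
  also have "[act N ?c ?y = ?y + N * ?y] (mod M)"
    using displaces_comm by (simp add: displaces_def)
  also have "?y + N * ?y = (1 + N) * ?y"
    by (simp add: algebra_simps)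
  also have "[(1 + N) * ?y = (1 + N) * ((x + N * - x) + 1)] (mod M)"
    using displaces_winv[OF displaces_comm]
    by (intro cong_mult cong_add cong_refl) (simp add: displaces_def)
  also have "(1 + N) * ((x + N * - x) + 1) = x + (1 + N) + N * (N * - x)"
    by (simp add: algebra_simps)
  also have "[x + (1 + N) + N * (N * - x) = x + (1 + N) + 0] (mod M)"
    by (intro cong_add cong_refl N_N_cong_0)
  finally show ?thesis by simp
qed

lemma alpha: "1 + 2 ^ m * l = 1 + N"
  by (simp add: two_power_m N_def)

lemma K_relations_eq:
  "K_relations m l = {(wconj wA (wcomm wA wB), wpow wA (1 + N)),
    (wconj wB (wcomm wB wA), wpow wB (1 + N)),
    (wpow wA M, []), (wpow wB M, []), (wpow (wcomm wA wB) h, [])}"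
  unfolding K_relations_def Let_def two_power_2m1 h_power alpha ..

lemma act_relations:
  assumes "(u, v) \<in> K_relations m l"
  shows "[act N u x = act N v x] (mod M)"
proof -
  have B: "displaces (wconj wB (wcomm wB wA)) (\<lambda>x. - (- x) + (tri x + - x))"
    unfolding wconj_def
    by (intro displaces_append displaces_winv displaces_comm_BA displaces_B)
  have "[(1 + N) * tri x = 1 * tri x] (mod h)" for x
    by (rule cong_mult) (simp_all add: cong_iff_dvd_diff N_def)
  then have "[act N (wconj wB (wcomm wB wA)) x = act N (wpow wB (1 + N)) x] (mod M)"
    by (intro displaces_imp_act_cong[OF B displaces_wpow[OF displaces_B]]) (simp add: cong_sym_eq)
  moreover have "[act N (wpow wB M) x = act N [] x] (mod M)"
    by (rule displaces_imp_act_cong[OF displaces_wpow[OF displaces_B] displaces_Nil])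
      (simp add: cong_0_iff M_def)
  moreover have "[act N (wpow (wcomm wA wB) h) x = act N [] x] (mod M)"
    by (rule displaces_imp_act_cong[OF displaces_wpow[OF displaces_comm] displaces_Nil])
      (simp add: cong_0_iff)
  moreover have "[act N (wpow wA M) x = act N [] x] (mod M)"
    by (simp add: act_wpow_A act_Nil cong_iff_dvd_diff)
  moreover have "[act N (wconj wA (wcomm wA wB)) x = act N (wpow wA (1 + N)) x] (mod M)"
    using act_conj_A by (simp add: act_wpow_A)
  ultimately show ?thesis
    using assms unfolding K_relations_eq by auto
qed

lemma act_pres_cong:
  assumes "pres_cong (K_relations m l) u v"
  shows "[act N u x = act N v x] (mod M)"
  using assms
proof (induction arbitrary: x)
  case (cancel g s)
  then show ?case
    using act_letter_inverse[of g s x] by (simp add: act_Cons act_Nil)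
next
  case (ctxt u v p q)
  then show ?case
    by (auto simp: act_append intro: act_cong)
qed (auto simp: act_relations intro: cong_sym cong_trans)

definition nf_word :: "int \<Rightarrow> int \<Rightarrow> int \<Rightarrow> gen word" where
  "nf_word i j k = wpow wA i @ wpow wB j @ wpow (wcomm wA wB) k"

lemma act_nf_word:
  "[act N (nf_word i j k) x = x + i + N * (j * tri (x + i) + k * (x + i))] (mod M)"
proof -
  have "displaces (wpow wB j @ wpow (wcomm wA wB) k) (\<lambda>x. j * tri x + k * x)"
    by (intro displaces_append displaces_wpow displaces_B displaces_comm)
  then show ?thesis
    by (simp add: nf_word_def act_append act_wpow_A displaces_def)
qed

text \<open>Since \<open>x + i\<close> is what \<open>b\<close> and \<open>c\<close> see, the points \<open>x + i = 0, -1, 1\<close> isolate the three exponents: at \<open>0\<close> both displacements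
  vanish, and at \<open>-1\<close> that of \<open>b\<close> does. The exponent of \<open>b\<close> is only detected modulo \<open>h\<close>,
  because \<open>b\<^sup>h\<close> acts trivially.\<close>

lemma nf_word_trivial:
  assumes "pres_cong (K_relations m l) (nf_word i j k) []"
  shows "M dvd i" "h dvd j" "h dvd k"
proof -
  have *: "[x + i + N * (j * tri (x + i) + k * (x + i)) = x] (mod M)" for x
    using act_nf_word act_pres_cong[OF assms] by (metis act_Nil cong_sym cong_trans)
  from *[of "- i"] show i: "M dvd i"
    by (simp add: cong_iff_dvd_diff)
  have "[N * (j * tri (y + i) + k * (y + i)) = 0] (mod M)" for y
    using dvd_diff[OF *[of y, unfolded cong_iff_dvd_diff] i]
    by (simp add: cong_0_iff algebra_simps)
  then have **: "h dvd j * tri (y + i) + k * (y + i)" for y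
    by (simp only: N_mult_cong_0_iff)
  from **[of "- 1 - i"] show k: "h dvd k" by simp
  from **[of "1 - i"] k show "h dvd j" by (simp add: dvd_add_left_iff)
qed

text \<open>Commuting with the translation \<open>a\<close> forces the action of a normal form to be a translation, which gives the
  statements on \<open>j\<close> and \<open>k\<close>; commuting with \<open>b\<close> then says that \<open>tri\<close> has period \<open>i\<close> modulo \<open>h\<close>.\<close>

lemma nf_word_central:
  assumes A: "pres_cong (K_relations m l) (nf_word i j k @ wA) (wA @ nf_word i j k)"
    and B: "pres_cong (K_relations m l) (nf_word i j k @ wB) (wB @ nf_word i j k)"
  shows "2 * h dvd i" "h dvd j" "h dvd k"
proof -
  define F where "F x = j * tri (x + i) + k * (x + i)" for x
  have nf: "[act N (nf_word i j k) x = x + i + N * F x] (mod M)" for x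
    using act_nf_word by (simp add: F_def)
  have "[x + i + N * F x + 1 = x + 1 + i + N * F (x + 1)] (mod M)" for x
  proof -
    have "[x + i + N * F x + 1 = act N (nf_word i j k @ wA) x] (mod M)"
      using cong_add[OF nf[of x] cong_refl[of 1]]
      by (simp add: act_append act_Cons act_Nil cong_sym_eq)
    also have "[act N (nf_word i j k @ wA) x = act N (wA @ nf_word i j k) x] (mod M)"
      by (rule act_pres_cong[OF A])
    also have "[act N (wA @ nf_word i j k) x = x + 1 + i + N * F (x + 1)] (mod M)"
      using nf[of "x + 1"] by (simp add: act_append act_Cons act_Nil)
    finally show ?thesis .
  qed
  moreover have "x + i + N * F x + 1 - (x + 1 + i + N * F (x + 1)) = N * (F x - F (x + 1))" for x
    unfolding right_diff_distrib by simp
  ultimately have "[N * (F x - F (x + 1)) = 0] (mod M)" for x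
    by (metis cong_iff_dvd_diff cong_0_iff)
  then have F: "h dvd F x - F (x + 1)" for x
    by (simp only: N_mult_cong_0_iff)
  from F[of "- 1 - i"] show k: "h dvd k" by (simp add: F_def)
  from F[of "- i"] k show j: "h dvd j" by (simp add: F_def dvd_diff_left_iff algebra_simps)
  have "[N * F x = 0] (mod M)" for x
    using j k unfolding N_mult_cong_0_iff by (simp add: F_def)
  then have nf: "[act N (nf_word i j k) x = x + i] (mod M)" for x
    using cong_trans[OF nf[of x]] cong_add[OF cong_refl[of "x + i" M], of "N * F x" 0] by simp
  have "[x + i + N * tri (x + i) = x + N * tri x + i] (mod M)" for x
  proof -
    have "[N * tri (x + i) = N * tri (act N (nf_word i j k) x)] (mod M)"
      using nf[of x] by (intro N_mult_cong tri_cong cong_M_imp_cong_2h) (simp add: cong_sym_eq)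
    then have "[x + i + N * tri (x + i) = act N (nf_word i j k @ wB) x] (mod M)"
      using cong_add[of "x + i" "act N (nf_word i j k) x" M] nf[of x]
      by (simp add: act_append act_Cons act_Nil cong_sym_eq)
    also have "[act N (nf_word i j k @ wB) x = act N (wB @ nf_word i j k) x] (mod M)"
      by (rule act_pres_cong[OF B])
    also have "[act N (wB @ nf_word i j k) x = x + N * tri x + i] (mod M)"
      using nf by (simp add: act_append act_Cons act_Nil)
    finally show ?thesis .
  qed
  moreover have "x + i + N * tri (x + i) - (x + N * tri x + i) = N * (tri (x + i) - tri x)" for x
    unfolding right_diff_distrib by simp
  ultimately have "[N * (tri (x + i) - tri x) = 0] (mod M)" for x
    by (metis cong_iff_dvd_diff cong_0_iff)
  then have T: "h dvd tri (x + i) - tri x" for x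
    by (simp only: N_mult_cong_0_iff)
  \<comment> \<open>Both \<open>tri 0\<close> and \<open>tri (-1)\<close> vanish, and \<open>tri i - tri (i - 1) = i\<close>. The factor 2 is gained from \<open>2 tri i = i (i + 1)\<close>,
    whose second factor is odd because \<open>h\<close> is even; this is where \<open>m > 1\<close> enters.\<close>
  have "h dvd tri i" "h dvd tri (i - 1)"
    using T[of 0] T[of "- 1"] by simp_all
  then have "h dvd i"
    using tri_diff[of i] by (simp add: dvd_add_right_iff)
  then have "odd (i + 1)"
    using even_h by auto
  moreover have "2 * h dvd i * (i + 1)"
    using \<open>h dvd tri i\<close> unfolding two_tri[symmetric] by simp
  ultimately show "2 * h dvd i"
    using coprime_dvd_mult_left_iff coprime_h_odd by blast
qed

end

section \<open>Normal form of the elements of K\<close>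

context group
begin

text \<open>The relation for \<open>b\<close> is written with \<open>[b, a] = c\<inverse>\<close>.\<close>

lemma K_relations_hold_iff:
  assumes "a \<in> carrier G" "b \<in> carrier G"
  defines "c \<equiv> inv a \<otimes> inv b \<otimes> a \<otimes> b"
  shows "(\<forall>u v. (u, v) \<in> K_relations m l \<longrightarrow>
      weval G (case_gen a b) u = weval G (case_gen a b) v) \<longleftrightarrow>
    inv c \<otimes> a \<otimes> c = a [^] (1 + 2 ^ m * l) \<and> c \<otimes> b \<otimes> inv c = b [^] (1 + 2 ^ m * l) \<and>
    a [^] (2 ^ (2 * m - 1) :: int) = \<one> \<and> b [^] (2 ^ (2 * m - 1) :: int) = \<one> \<and>
    c [^] (2 ^ (m - 1) :: int) = \<one>"
proof -
  have f: "\<And>x. case_gen a b x \<in> carrier G"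
    using assms by (simp split: gen.split)
  have c: "c \<in> carrier G"
    using assms by simp
  have "inv c = inv b \<otimes> (inv a \<otimes> (inv (inv b) \<otimes> inv (inv a)))"
    unfolding c_def using assms(1,2) by (simp only: inv_mult_group m_closed inv_closed)
  then have inv_c: "inv b \<otimes> inv a \<otimes> b \<otimes> a = inv c"
    using assms(1,2) by (simp add: m_assoc)
  have ab: "weval G (case_gen a b) [(GenA, False)] = a" "weval G (case_gen a b) [(GenB, False)] = b"
    using assms by simp_all
  have comm: "weval G (case_gen a b) (wcomm [(GenA, False)] [(GenB, False)]) = c"
    unfolding wcomm_def weval_append[OF f] weval_winv[OF f] ab c_def
    using assms(1,2) by (simp add: m_assoc)
  have comm': "weval G (case_gen a b) (wcomm [(GenB, False)] [(GenA, False)]) = inv c"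
    unfolding wcomm_def weval_append[OF f] weval_winv[OF f] ab inv_c[symmetric]
    using assms(1,2) by (simp add: m_assoc)
  show ?thesis
    unfolding K_relations_def Let_def
    apply (simp add: all_conj_distrib imp_conjR del: weval.simps)
    apply (simp only: wconj_def weval_append[OF f] weval_winv[OF f] weval_wpow[OF f] ab comm comm'
        weval.simps(1))
    using assms c by (simp add: m_assoc)
qed

end

lemma range_case_gen: "range (case_gen x y) = {x, y}"
proof -
  have "range (case_gen x y) = case_gen x y ` {GenA, GenB}"
    by (metis UNIV_eq_I gen.exhaust insertCI)
  then show ?thesis by simp
qed

locale K_group = parameters m l + group K
  for K :: "('a, 'b) monoid_scheme" (structure) and a b :: 'a and m l +
  assumes is_K: "is_K m l K a b"
begin

definition c where "c = inv a \<otimes> inv b \<otimes> a \<otimes> b"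

lemma presentation: "has_presentation K (case_gen a b) (K_relations m l)"
  using is_K by (simp add: is_K_def)

lemma a [simp, intro]: "a \<in> carrier K" and b [simp, intro]: "b \<in> carrier K"
  and generate_ab: "generate K {a, b} = carrier K"
  using presentation unfolding has_presentation_def range_case_gen by auto

lemma c [simp, intro]: "c \<in> carrier K"
  by (simp add: c_def)

lemma gens: "case_gen a b x \<in> carrier K"
  by (simp split: gen.split)

lemma weval_eq_iff:
  "weval K (case_gen a b) u = weval K (case_gen a b) v \<longleftrightarrow> pres_cong (K_relations m l) u v"
  using presentation by (simp add: has_presentation_def)

lemma c_conj_a: "inv c \<otimes> a \<otimes> c = a [^] (1 + N)"
  and c_conj_b: "c \<otimes> b \<otimes> inv c = b [^] (1 + N)"
  and a_M: "a [^] M = \<one>" and b_M: "b [^] M = \<one>" and c_h: "c [^] h = \<one>"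
  using K_relations_hold_iff[OF a b, folded c_def, of m l] weval_eq_iff pres_cong.rel[of _ _ "K_relations m l"]
  unfolding alpha two_power_2m1 h_power by blast+

lemma inv_c: "inv c = inv b \<otimes> inv a \<otimes> b \<otimes> a"
proof -
  have "inv c = inv b \<otimes> (inv a \<otimes> (inv (inv b) \<otimes> inv (inv a)))"
    unfolding c_def by (simp only: a b inv_mult_group m_closed inv_closed)
  then show ?thesis by (simp add: m_assoc)
qed

end

text \<open>The relations are invariant under exchanging the generators, because \<open>c\<inverse>\<close> satisfies the power
  relation of \<open>c\<close>. So every fact about \<open>(a, b, c)\<close> also holds for \<open>(b, a, c\<inverse>)\<close>.\<close>

lemma (in K_group) swap: "K_group K b a m l"
proof -
  define sw where "sw = map (\<lambda>(g, s). (case_gen GenB GenA g, s :: bool))"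
  have sw_sw: "sw (sw u) = u" for u
    by (induction u) (auto simp: sw_def split: gen.split)
  have eval_sw: "weval K (case_gen b a) u = weval K (case_gen a b) (sw u)" for u
    by (induction u) (auto simp: sw_def split: gen.splits)
  have "inv c [^] h = \<one>"
    using c_h by (simp add: int_pow_inv)
  then have rel: "\<forall>u v. (u, v) \<in> K_relations m l \<longrightarrow>
      weval K (case_gen b a) u = weval K (case_gen b a) v"
    unfolding K_relations_hold_iff[OF b a, folded inv_c] alpha two_power_2m1 h_power
    using c_conj_a c_conj_b a_M b_M by simp
  have gens': "\<And>x. case_gen b a x \<in> carrier K"
    by (simp split: gen.split)
  have sound: "weval K (case_gen b a) u = weval K (case_gen b a) v"
    if "pres_cong (K_relations m l) u v" for u v
    using weval_pres_cong[of "case_gen b a" "K_relations m l", OF gens' _ that] rel by blast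
  have "weval K (case_gen b a) u = weval K (case_gen b a) v \<longleftrightarrow> pres_cong (K_relations m l) u v"
    for u v
  proof
    assume "weval K (case_gen b a) u = weval K (case_gen b a) v"
    then have "pres_cong (K_relations m l) (sw u) (sw v)"
      unfolding eval_sw weval_eq_iff .
    from sound[OF this] show "pres_cong (K_relations m l) u v"
      unfolding eval_sw sw_sw weval_eq_iff .
  qed (rule sound)
  moreover have "generate K {b, a} = carrier K"
    using generate_ab by (simp add: insert_commute)
  ultimately have "is_K m l K b a"
    unfolding is_K_def has_presentation_def range_case_gen using is_group by auto
  then show ?thesis
    by (intro K_group.intro K_group_axioms.intro parameters_axioms is_group)
qed

context K_group
begin

lemma swap_c: "K_group.c K b a = inv c"
  unfolding K_group.c_def[OF swap] inv_c ..

lemma N_dvd: "2 * h dvd N"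
  by (simp add: N_def)

lemma a_N_commutes_c: "a [^] N \<otimes> c = c \<otimes> a [^] N"
proof -
  have "inv c \<otimes> a [^] N \<otimes> c = a [^] ((1 + N) * N)"
    by (simp add: int_pow_conj c_conj_a int_pow_pow)
  also have "\<dots> = a [^] N \<otimes> a [^] (N * N)"
    by (simp add: int_pow_mult distrib_right)
  also have "a [^] (N * N) = \<one>"
    by (rule int_pow_dvd_eq_one[OF a a_M]) (simp add: N_def M_def)
  finally show ?thesis by (simp add: conj_eq_iff)
qed

lemma ab: "a \<otimes> b = b \<otimes> a \<otimes> c"
  by (simp add: c_def m_assoc mult_inv_cancel)

lemma c_a: "c \<otimes> a = a \<otimes> c \<otimes> a [^] (- N)"
proof -
  have "a \<otimes> c = c \<otimes> (a \<otimes> a [^] N)"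
    using c_conj_a conj_eq_iff[of a "a [^] (1 + N)" c] by (simp add: int_pow_mult)
  then have "a \<otimes> c \<otimes> a [^] (- N) = c \<otimes> (a \<otimes> (a [^] N \<otimes> a [^] (- N)))"
    by (simp add: m_assoc)
  then show ?thesis by (simp add: int_pow_neg)
qed

text \<open>In the collection formula the power \<open>c\<^sup>2\<^sup>h\<close> vanishes, and the commutator \<open>a\<^sup>-\<^sup>N\<close> of \<open>a\<close> and \<open>c\<close> is raised to
  \<open>h(2h - 1)\<close>, a multiple of its order.\<close>

lemma ac_pow_2h: "(a \<otimes> c) [^] (2 * h) = a [^] (2 * h)"
proof -
  define n where "n = nat (2 * h)"
  have n: "int n = 2 * h" using h_pos by (simp add: n_def)
  have C: "int (n choose 2) = h * (2 * h - 1)"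
  proof -
    have "n choose 2 = nat h * (n - 1)"
      using h_pos by (simp add: choose_two n_def nat_mult_distrib)
    moreover have "int (n - 1) = 2 * h - 1"
      using n h_pos by linarith
    ultimately show ?thesis
      using h_pos by simp
  qed
  let ?w = "a [^] (- N)"
  have "?w \<otimes> a = a \<otimes> ?w"
    by (rule int_pow_commute) simp_all
  moreover have "?w \<otimes> c = c \<otimes> ?w"
    using commute_inv[OF a_N_commutes_c] by (simp add: int_pow_neg)
  ultimately have "(a \<otimes> c) [^] n = a [^] n \<otimes> c [^] n \<otimes> ?w [^] (n choose 2)"
    by (intro nat_pow_mult_commutator c_a) simp_all
  then have "(a \<otimes> c) [^] int n = a [^] int n \<otimes> c [^] int n \<otimes> a [^] (- N * int (n choose 2))"
    by (simp only: int_pow_int[symmetric] int_pow_pow a)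
  moreover have "c [^] int n = \<one>"
    by (rule int_pow_dvd_eq_one[OF c c_h]) (simp add: n)
  moreover have "a [^] (- N * int (n choose 2)) = \<one>"
    by (rule int_pow_dvd_eq_one[OF a a_M]) (simp add: C N_def M_def)
  ultimately show ?thesis by (simp add: n)
qed

lemma a_2h_central: "a [^] (2 * h) \<in> center K"
proof (rule center_if_commutes_with_generators[OF _ generate_ab])
  have "inv b \<otimes> a \<otimes> b = a \<otimes> c"
    using ab conj_eq_iff[of a "a \<otimes> c" b] by (simp add: m_assoc)
  then have "inv b \<otimes> a [^] (2 * h) \<otimes> b = a [^] (2 * h)"
    by (simp add: int_pow_conj ac_pow_2h)
  then have "a [^] (2 * h) \<otimes> b = b \<otimes> a [^] (2 * h)"
    by (simp add: conj_eq_iff)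
  moreover have "a [^] (2 * h) \<otimes> a = a \<otimes> a [^] (2 * h)"
    by (rule int_pow_commute) simp_all
  ultimately show "a [^] (2 * h) \<otimes> s = s \<otimes> a [^] (2 * h)" if "s \<in> {a, b}" for s
    using that by auto
qed auto

lemma center_int_pow: "z \<in> center K \<Longrightarrow> z [^] (k::int) \<in> center K"
  by (meson center_normal normal_imp_subgroup subgroup_int_pow_closed)

lemma a_central: "2 * h dvd i \<Longrightarrow> a [^] i \<in> center K"
  using center_int_pow[OF a_2h_central] by (auto simp: int_pow_pow elim!: dvdE)

lemma b_central: "2 * h dvd i \<Longrightarrow> b [^] i \<in> center K"
  by (rule K_group.a_central[OF swap])

definition nf :: "int \<Rightarrow> int \<Rightarrow> int \<Rightarrow> 'a" where
  "nf i j k = a [^] i \<otimes> b [^] j \<otimes> c [^] k"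

lemma nf_closed [simp, intro]: "nf i j k \<in> carrier K"
  by (simp add: nf_def)

lemma nf_eq_weval: "nf i j k = weval K (case_gen a b) (nf_word i j k)"
  unfolding nf_word_def wcomm_def weval_append[OF gens] weval_wpow[OF gens] weval_winv[OF gens]
  by (simp add: nf_def c_def m_assoc)

text \<open>The exponent of \<open>b\<close> is first obtained only modulo \<open>h\<close>; \<open>nf_eq_iff\<close> sharpens this to \<open>M\<close>.\<close>

lemma nf_eq_one:
  assumes "nf i j k = \<one>"
  shows "M dvd i" "h dvd j" "h dvd k"
proof -
  have "weval K (case_gen a b) (nf_word i j k) = weval K (case_gen a b) []"
    using assms by (simp add: nf_eq_weval)
  from nf_word_trivial[OF this[unfolded weval_eq_iff]] show "M dvd i" "h dvd j" "h dvd k" .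
qed

lemma nf_central_weak:
  assumes "nf i j k \<in> center K"
  shows "2 * h dvd i" "h dvd j" "h dvd k"
proof -
  have "weval K (case_gen a b) (nf_word i j k @ wA) = weval K (case_gen a b) (wA @ nf_word i j k)"
    "weval K (case_gen a b) (nf_word i j k @ wB) = weval K (case_gen a b) (wB @ nf_word i j k)"
    unfolding weval_append[OF gens] nf_eq_weval[symmetric]
    using center_commute[OF assms a] center_commute[OF assms b] by simp_all
  from nf_word_central[OF this[unfolded weval_eq_iff]]
  show "2 * h dvd i" "h dvd j" "h dvd k" .
qed

text \<open>This is the centre of \<open>K\<close> (\<open>center_eq_Z\<close>). It is introduced in explicit form because the normal form, on which the
  computation of the centre rests, is obtained by computing modulo this subgroup.\<close>

definition Z where "Z = {a [^] i \<otimes> b [^] j | i j. 2 * h dvd i \<and> 2 * h dvd j}"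

lemma ZI: "2 * h dvd i \<Longrightarrow> 2 * h dvd j \<Longrightarrow> z = a [^] i \<otimes> b [^] j \<Longrightarrow> z \<in> Z"
  unfolding Z_def by blast

lemma Z_central: "Z \<subseteq> center K"
  unfolding Z_def using a_central b_central subgroup.m_closed[OF normal_imp_subgroup[OF center_normal]]
  by blast

lemma Z_mult_nf:
  assumes "z \<in> Z"
  obtains r s where "2 * h dvd r" "2 * h dvd s" "\<And>i j k. z \<otimes> nf i j k = nf (i + r) (j + s) k"
proof -
  from assms obtain r s where rs: "2 * h dvd r" "2 * h dvd s" "z = a [^] r \<otimes> b [^] s"
    unfolding Z_def by blast
  have "z \<otimes> nf i j k = nf (i + r) (j + s) k" for i j k
  proof -
    have "z \<otimes> nf i j k = a [^] r \<otimes> (b [^] s \<otimes> a [^] i) \<otimes> b [^] j \<otimes> c [^] k"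
      by (simp add: nf_def rs m_assoc)
    also have "\<dots> = (a [^] r \<otimes> a [^] i) \<otimes> (b [^] s \<otimes> b [^] j) \<otimes> c [^] k"
      unfolding center_commute[OF b_central[OF rs(2)] int_pow_closed[OF a]] by (simp add: m_assoc)
    also have "\<dots> = nf (i + r) (j + s) k"
      by (simp add: nf_def add.commute flip: int_pow_mult)
    finally show ?thesis .
  qed
  with rs show thesis using that by blast
qed

lemma Z_subgroup: "subgroup Z K"
proof (rule subgroupI)
  show "Z \<subseteq> carrier K" using Z_central by blast
  show "Z \<noteq> {}" unfolding Z_def by blast
  fix x assume x: "x \<in> Z"
  then obtain i j where ij: "2 * h dvd i" "2 * h dvd j" "x = a [^] i \<otimes> b [^] j"
    unfolding Z_def by blast
  have "inv x = b [^] (- j) \<otimes> a [^] (- i)"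
    by (simp add: ij inv_mult_group int_pow_neg)
  also have "\<dots> = a [^] (- i) \<otimes> b [^] (- j)"
    using ij by (intro center_commute[OF b_central]) simp_all
  finally have "inv x = a [^] (- i) \<otimes> b [^] (- j)" .
  moreover have "2 * h dvd - i" "2 * h dvd - j"
    using ij by simp_all
  ultimately show "inv x \<in> Z"
    using ZI by blast
  fix y assume "y \<in> Z"
  obtain r s where rs: "2 * h dvd r" "2 * h dvd s" "\<And>i j k. y \<otimes> nf i j k = nf (i + r) (j + s) k"
    using Z_mult_nf[OF \<open>y \<in> Z\<close>] by metis
  have "x \<otimes> y = y \<otimes> x"
    using x \<open>y \<in> Z\<close> Z_central center_commute[of x y] by blast
  moreover have "x = nf i j 0"
    by (simp add: nf_def ij(3))
  ultimately have "x \<otimes> y = y \<otimes> nf i j 0" by (simp only:)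
  then have "x \<otimes> y = a [^] (i + r) \<otimes> b [^] (j + s)"
    unfolding rs(3) by (simp add: nf_def)
  moreover have "2 * h dvd i + r" "2 * h dvd j + s"
    using ij(1,2) rs(1,2) by simp_all
  ultimately show "x \<otimes> y \<in> Z"
    using ZI by blast
qed

lemma Z_normal: "Z \<lhd> K"
  by (rule central_subgroup_normal[OF Z_subgroup Z_central])

lemma a_in_Z: "2 * h dvd i \<Longrightarrow> a [^] i \<in> Z"
  by (rule ZI[of i 0]) simp_all

lemma b_in_Z: "2 * h dvd i \<Longrightarrow> b [^] i \<in> Z"
  by (rule ZI[of 0 i]) simp_all

text \<open>Modulo \<open>Z\<close> the element \<open>c\<close> commutes with \<open>a\<close> and \<open>b\<close>, so the formula for Heisenberg groups applies in \<open>K/Z\<close>.\<close>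

lemma nf_mult: "\<exists>z\<in>Z. nf i j k \<otimes> nf i' j' k' = z \<otimes> nf (i + i') (j + j') (k + k' - j * i')"
proof -
  interpret Z: normal Z K by (rule Z_normal)
  interpret Q: group "K Mod Z" by (rule Z.factorgroup_is_group)
  let ?q = "\<lambda>g. Z #> g"
  have q_mult: "?q x \<otimes>\<^bsub>K Mod Z\<^esub> ?q y = ?q (x \<otimes> y)" if "x \<in> carrier K" "y \<in> carrier K" for x y
    using that by (simp add: Z.rcos_sum)
  have q_cl: "?q x \<in> carrier (K Mod Z)" if "x \<in> carrier K" for x
    using that by (auto simp: carrier_FactGroup)
  have q_pow: "?q x [^]\<^bsub>K Mod Z\<^esub> (k::int) = ?q (x [^] k)" if "x \<in> carrier K" for x k
    using that by (rule Z.FactGroup_int_pow)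
  have comm: "?q (x \<otimes> y) = ?q (y \<otimes> x)"
    if "x \<in> carrier K" "y \<in> carrier K" "z \<in> Z" "x \<otimes> y = y \<otimes> x \<otimes> z" for x y z
  proof -
    have "x \<otimes> y = z \<otimes> (y \<otimes> x)"
      using that Z_central center_commute[of z "y \<otimes> x"] by auto
    then show ?thesis using rcos_eq_iff[OF Z_normal] that by auto
  qed
  have "?q a \<otimes>\<^bsub>K Mod Z\<^esub> ?q b = ?q b \<otimes>\<^bsub>K Mod Z\<^esub> ?q a \<otimes>\<^bsub>K Mod Z\<^esub> ?q c"
    by (simp add: q_mult ab del: mult_FactGroup)
  moreover have "?q c \<otimes>\<^bsub>K Mod Z\<^esub> ?q a = ?q a \<otimes>\<^bsub>K Mod Z\<^esub> ?q c"
    using comm[OF c a a_in_Z c_a] N_dvd by (simp add: q_mult del: mult_FactGroup)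
  moreover have "?q c \<otimes>\<^bsub>K Mod Z\<^esub> ?q b = ?q b \<otimes>\<^bsub>K Mod Z\<^esub> ?q c"
  proof -
    have "b \<otimes> inv c = inv c \<otimes> b \<otimes> b [^] N"
    proof -
      have "inv (inv c) \<otimes> b \<otimes> inv c = b [^] (1 + N)"
        using c_conj_b by simp
      then show ?thesis
        using conj_eq_iff[of b "b [^] (1 + N)" "inv c"] by (simp add: int_pow_mult m_assoc)
    qed
    then have "c \<otimes> (b \<otimes> inv c) \<otimes> c = c \<otimes> (inv c \<otimes> b \<otimes> b [^] N) \<otimes> c"
      by simp
    then have "c \<otimes> b = b \<otimes> (b [^] N \<otimes> c)"
      by (simp add: m_assoc mult_inv_cancel)
    also have "b [^] N \<otimes> c = c \<otimes> b [^] N"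
      using b_central[OF N_dvd] by (rule center_commute) simp
    finally have "c \<otimes> b = b \<otimes> c \<otimes> b [^] N" by (simp add: m_assoc)
    from comm[OF c b b_in_Z this] N_dvd show ?thesis
      by (simp add: q_mult del: mult_FactGroup)
  qed
  ultimately have "(?q a [^]\<^bsub>K Mod Z\<^esub> i \<otimes>\<^bsub>K Mod Z\<^esub> ?q b [^]\<^bsub>K Mod Z\<^esub> j \<otimes>\<^bsub>K Mod Z\<^esub> ?q c [^]\<^bsub>K Mod Z\<^esub> k) \<otimes>\<^bsub>K Mod Z\<^esub>
      (?q a [^]\<^bsub>K Mod Z\<^esub> i' \<otimes>\<^bsub>K Mod Z\<^esub> ?q b [^]\<^bsub>K Mod Z\<^esub> j' \<otimes>\<^bsub>K Mod Z\<^esub> ?q c [^]\<^bsub>K Mod Z\<^esub> k') =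
    ?q a [^]\<^bsub>K Mod Z\<^esub> (i + i') \<otimes>\<^bsub>K Mod Z\<^esub> ?q b [^]\<^bsub>K Mod Z\<^esub> (j + j') \<otimes>\<^bsub>K Mod Z\<^esub> ?q c [^]\<^bsub>K Mod Z\<^esub> (k + k' - j * i')"
    by (intro Q.class2_mult q_cl) simp_all
  then have "?q (nf i j k \<otimes> nf i' j' k') = ?q (nf (i + i') (j + j') (k + k' - j * i'))"
    by (simp add: q_pow q_mult nf_def del: mult_FactGroup)
  then show ?thesis
    using rcos_eq_iff[OF Z_normal] by blast
qed

lemma carrier_nf_cases:
  assumes "g \<in> carrier K"
  obtains i j k where "g = nf i j k"
proof -
  have "g \<in> generate K {a, b}" using assms generate_ab by simp
  then have "\<exists>i j k. g = nf i j k"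
  proof (induction rule: generate.induct)
    case one
    show ?case by (intro exI[of _ 0]) (simp add: nf_def)
  next
    case (incl g)
    have "a = nf 1 0 0" "b = nf 0 1 0" by (simp_all add: nf_def)
    then show ?case using incl by blast
  next
    case (inv g)
    have "inv a = nf (- 1) 0 0" "inv b = nf 0 (- 1) 0" by (simp_all add: nf_def int_pow_neg)
    then show ?case using inv by blast
  next
    case (eng g g')
    then obtain i j k i' j' k' where eq: "g = nf i j k" "g' = nf i' j' k'" by blast
    then obtain z where "z \<in> Z" "g \<otimes> g' = z \<otimes> nf (i + i') (j + j') (k + k' - j * i')"
      using nf_mult by blast
    then show ?case by (metis Z_mult_nf)
  qed
  then show thesis using that by blast
qed

text \<open>Multiplying both sides by the normal form that inverts the right hand side modulo \<open>Z\<close> gives a central normal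
  form, to which \<open>nf_central_weak\<close> applies.\<close>

lemma nf_eq_imp_k_cong:
  assumes "z \<in> Z" "nf i j k = z \<otimes> nf i' j' k'"
  shows "h dvd k - k'"
proof -
  let ?n = "nf (- i') (- j') (- k' - j' * i')"
  let ?d = "nf (i + - i') (j + - j') (k + (- k' - j' * i') - j * - i')"
  obtain z1 where z1: "z1 \<in> Z" "nf i j k \<otimes> ?n = z1 \<otimes> ?d"
    using nf_mult by blast
  obtain z2 where z2: "z2 \<in> Z"
    "nf i' j' k' \<otimes> ?n = z2 \<otimes> nf (i' + - i') (j' + - j') (k' + (- k' - j' * i') - j' * - i')"
    using nf_mult by blast
  have "nf (i' + - i') (j' + - j') (k' + (- k' - j' * i') - j' * - i') = \<one>"
    by (simp add: nf_def)
  then have z2': "nf i' j' k' \<otimes> ?n = z2"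
    using z2 Z_central by auto
  have cl: "z \<in> carrier K" "z1 \<in> carrier K" "z2 \<in> carrier K"
    using z1 z2 assms Z_central by blast+
  have "z1 \<otimes> ?d = z \<otimes> (nf i' j' k' \<otimes> ?n)"
    unfolding z1(2)[symmetric] assms(2) by (rule m_assoc) (use cl in auto)
  also have "\<dots> = z \<otimes> z2"
    by (simp only: z2')
  finally have "inv z1 \<otimes> (z1 \<otimes> ?d) = inv z1 \<otimes> (z \<otimes> z2)"
    by (simp only:)
  then have "?d = inv z1 \<otimes> (z \<otimes> z2)"
    using cl by (simp only: mult_inv_cancel nf_closed)
  moreover have "inv z1 \<otimes> (z \<otimes> z2) \<in> Z"
    using z1(1) z2(1) assms(1) Z_subgroup by (simp add: subgroup.m_closed subgroup.m_inv_closed)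
  ultimately have "?d \<in> center K"
    using Z_central by auto
  then have j: "h dvd j + - j'" and k: "h dvd k + (- k' - j' * i') - j * - i'"
    using nf_central_weak by blast+
  have "(k + (- k' - j' * i') - j * - i') - (j + - j') * i' = k - k'"
    by (simp add: ring_distribs)
  moreover have "h dvd (k + (- k' - j' * i') - j * - i') - (j + - j') * i'"
    by (intro dvd_diff dvd_mult2 k j)
  ultimately show ?thesis by (simp only:)
qed

lemma int_pow_eq_iff:
  assumes "x \<in> carrier K"
  shows "x [^] (i::int) = x [^] (i'::int) \<longleftrightarrow> x [^] (i - i') = \<one>"
  using assms by (simp add: int_pow_diff inv_solve_right')

text \<open>Once the powers of \<open>c\<close> are cancelled, the action separates the powers of \<open>a\<close>, and the action
  with \<open>a\<close> and \<open>b\<close> exchanged separates the powers of \<open>b\<close>.\<close>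

lemma nf_eq_iff:
  "nf i j k = nf i' j' k' \<longleftrightarrow> [i = i'] (mod M) \<and> [j = j'] (mod M) \<and> [k = k'] (mod h)"
proof
  assume eq: "nf i j k = nf i' j' k'"
  have "h dvd k - k'"
    using nf_eq_imp_k_cong[of \<one> i j k i' j' k'] eq subgroup.one_closed[OF Z_subgroup] by simp
  then have "c [^] k = c [^] k'"
    unfolding int_pow_eq_iff[OF c] by (rule int_pow_dvd_eq_one[OF c c_h])
  then have ab: "a [^] i \<otimes> b [^] j = a [^] i' \<otimes> b [^] j'"
    using eq by (simp add: nf_def)
  have "nf (i - i') (j - j') 0 = inv (a [^] i') \<otimes> (a [^] i \<otimes> b [^] j) \<otimes> inv (b [^] j')"
    unfolding nf_def diff_conv_add_uminus add.commute[of i]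
    by (simp only: int_pow_mult int_pow_neg a b int_pow_closed inv_closed m_closed m_assoc c int_pow_0 r_one)
  also have "\<dots> = \<one>"
    unfolding ab by (simp add: m_assoc mult_inv_cancel)
  finally have i: "M dvd i - i'"
    by (rule nf_eq_one)
  then have "a [^] i = a [^] i'"
    unfolding int_pow_eq_iff[OF a] by (rule int_pow_dvd_eq_one[OF a a_M])
  then have "b [^] j = b [^] j'" using ab by simp
  then have "K_group.nf K b a (j - j') 0 0 = \<one>"
    unfolding K_group.nf_def[OF swap] int_pow_eq_iff[OF b] using swap_c by simp
  then have "M dvd j - j'"
    by (rule K_group.nf_eq_one[OF swap])
  with i \<open>h dvd k - k'\<close> show "[i = i'] (mod M) \<and> [j = j'] (mod M) \<and> [k = k'] (mod h)"
    by (simp add: cong_iff_dvd_diff)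
next
  assume "[i = i'] (mod M) \<and> [j = j'] (mod M) \<and> [k = k'] (mod h)"
  then have "a [^] i = a [^] i'" "b [^] j = b [^] j'" "c [^] k = c [^] k'"
    unfolding int_pow_eq_iff[OF a] int_pow_eq_iff[OF b] int_pow_eq_iff[OF c] cong_iff_dvd_diff
    using int_pow_dvd_eq_one a_M b_M c_h a b c by blast+
  then show "nf i j k = nf i' j' k'" by (simp add: nf_def)
qed

lemma finite_carrier: "finite (carrier K)"
proof -
  have "carrier K \<subseteq> (\<lambda>(i, j, k). nf i j k) ` ({0..<M} \<times> {0..<M} \<times> {0..<h})"
  proof
    fix g assume "g \<in> carrier K"
    then obtain i j k where "g = nf i j k" by (rule carrier_nf_cases)
    also have "\<dots> = nf (i mod M) (j mod M) (k mod h)"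
      by (simp add: nf_eq_iff)
    finally show "g \<in> (\<lambda>(i, j, k). nf i j k) ` ({0..<M} \<times> {0..<M} \<times> {0..<h})"
      using h_pos by (intro image_eqI[of _ _ "(i mod M, j mod M, k mod h)"]) (auto simp: M_def)
  qed
  then show ?thesis by (rule finite_subset) simp
qed

end

section \<open>The first two centres of K\<close>

context K_group
begin

text \<open>For a central normal form the action shows that \<open>a\<^sup>i \<in> Z\<close> and \<open>c\<^sup>k = 1\<close>. So \<open>b\<^sup>j\<close> is central, too, and exchanging the
  generators shows that it lies in \<open>Z\<close>.\<close>

lemma center_eq_Z: "center K = Z"
proof
  show "center K \<subseteq> Z"
  proof
    fix g assume g: "g \<in> center K"
    then obtain i j k where nf: "g = nf i j k"
      using carrier_nf_cases by blast
    then have ijk: "2 * h dvd i" "h dvd j" "h dvd k"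
      using nf_central_weak g by blast+
    have "c [^] k = \<one>"
      using ijk int_pow_dvd_eq_one[OF c c_h] by blast
    then have g_eq: "g = a [^] i \<otimes> b [^] j"
      by (simp add: nf nf_def)
    then have "b [^] j = inv (a [^] i) \<otimes> g"
      by (simp add: mult_inv_cancel)
    moreover have "inv (a [^] i) \<otimes> g \<in> center K"
      using a_central[OF ijk(1)] g normal_imp_subgroup[OF center_normal]
      by (simp add: subgroup.m_closed subgroup.m_inv_closed)
    ultimately have "K_group.nf K b a j 0 0 \<in> center K"
      unfolding K_group.nf_def[OF swap] using swap_c by simp
    then have "2 * h dvd j"
      by (rule K_group.nf_central_weak[OF swap])
    then show "g \<in> Z"
      unfolding Z_def using g_eq ijk by blast
  qed
qed (rule Z_central)

definition W where "W = upper_central K 2"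

lemma W_iff: "x \<in> W \<longleftrightarrow> x \<in> carrier K \<and> (\<forall>g\<in>carrier K. \<exists>z\<in>Z. x \<otimes> g = z \<otimes> (g \<otimes> x))"
  unfolding W_def upper_central_2_iff center_eq_Z ..

text \<open>By \<open>nf_mult\<close> the two products of normal forms differ by \<open>c\<close> to the power \<open>j'i - ji'\<close> modulo \<open>Z\<close>. This is
  trivial for all \<open>i'\<close>, \<open>j'\<close> if \<open>h\<close> divides \<open>i\<close> and \<open>j\<close>, and testing \<open>a\<close> and \<open>b\<close> shows the converse.\<close>

lemma nf_in_W:
  assumes "h dvd i" "h dvd j"
  shows "nf i j k \<in> W"
  unfolding W_iff
proof (intro conjI ballI)
  fix g assume "g \<in> carrier K"
  then obtain i' j' k' where g: "g = nf i' j' k'" by (rule carrier_nf_cases)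
  obtain z1 where z1: "z1 \<in> Z" "nf i j k \<otimes> g = z1 \<otimes> nf (i + i') (j + j') (k + k' - j * i')"
    using nf_mult unfolding g by blast
  obtain z2 where z2: "z2 \<in> Z" "g \<otimes> nf i j k = z2 \<otimes> nf (i' + i) (j' + j) (k' + k - j' * i)"
    using nf_mult unfolding g by blast
  have "[k + k' - j * i' = k' + k - j' * i] (mod h)"
    using assms by (simp add: cong_iff_dvd_diff)
  then have eq: "nf (i + i') (j + j') (k + k' - j * i') = nf (i' + i) (j' + j) (k' + k - j' * i)"
    by (simp add: nf_eq_iff add.commute)
  have cl: "z1 \<in> carrier K" "z2 \<in> carrier K"
    using z1 z2 Z_central by auto
  have "nf i j k \<otimes> g = (z1 \<otimes> inv z2) \<otimes> (g \<otimes> nf i j k)"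
    unfolding z1(2) z2(2) eq using cl by (simp add: m_assoc mult_inv_cancel)
  moreover have "z1 \<otimes> inv z2 \<in> Z"
    using z1 z2 Z_subgroup by (simp add: subgroup.m_closed subgroup.m_inv_closed)
  ultimately show "\<exists>z\<in>Z. nf i j k \<otimes> g = z \<otimes> (g \<otimes> nf i j k)" by blast
qed simp

lemma W_nf:
  assumes "nf i j k \<in> W"
  shows "h dvd i" "h dvd j"
proof -
  have key: "h dvd (k + k' - j * i') - (k' + k - j' * i)" for i' j' k'
  proof -
    obtain z where z: "z \<in> Z" "nf i j k \<otimes> nf i' j' k' = z \<otimes> (nf i' j' k' \<otimes> nf i j k)"
      using assms unfolding W_iff by (meson nf_closed)
    obtain z1 where z1: "z1 \<in> Z"
      "nf i j k \<otimes> nf i' j' k' = z1 \<otimes> nf (i + i') (j + j') (k + k' - j * i')"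
      using nf_mult by blast
    obtain z2 where z2: "z2 \<in> Z"
      "nf i' j' k' \<otimes> nf i j k = z2 \<otimes> nf (i' + i) (j' + j) (k' + k - j' * i)"
      using nf_mult by blast
    have cl: "z \<in> carrier K" "z1 \<in> carrier K" "z2 \<in> carrier K"
      using z z1 z2 Z_central by auto
    have "nf (i + i') (j + j') (k + k' - j * i') = inv z1 \<otimes> (nf i j k \<otimes> nf i' j' k')"
      unfolding z1(2) using cl by (simp add: mult_inv_cancel)
    also have "\<dots> = (inv z1 \<otimes> (z \<otimes> z2)) \<otimes> nf (i' + i) (j' + j) (k' + k - j' * i)"
      unfolding z(2) z2(2) using cl by (simp add: m_assoc)
    finally show ?thesis
      using z z1 z2 Z_subgroup
      by (intro nf_eq_imp_k_cong) (auto simp: subgroup.m_closed subgroup.m_inv_closed)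
  qed
  have "(k + 0 - j * 0) - (0 + k - 1 * i) = i" "(k + 0 - j * 1) - (0 + k - 0 * i) = - j"
    by simp_all
  with key[of 0 0 1] key[of 0 1 0] show "h dvd i" "h dvd j"
    by (simp_all only: dvd_minus_iff)
qed

lemma W_cases:
  assumes "x \<in> W"
  obtains i j k where "x = nf (h * i) (h * j) k"
proof -
  obtain i j k where "x = nf i j k"
    using assms carrier_nf_cases unfolding W_iff by blast
  then show thesis using W_nf[of i j k] that assms by (auto elim!: dvdE)
qed

lemma card_W: "card W = 2 ^ (3 * m - 1)"
proof -
  let ?f = "\<lambda>(i, j, k). nf (h * i) (h * j) k"
  let ?S = "{0..<2 * h} \<times> {0..<2 * h} \<times> {0..<h}"
  have cong: "[h * i = h * i'] (mod M) \<longleftrightarrow> [i = i'] (mod 2 * h)" for i i'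
    using h_pos by (simp add: cong_iff_dvd_diff M_def flip: right_diff_distrib)
  have "inj_on ?f ?S"
    by (auto simp: inj_on_def nf_eq_iff cong intro: cong_less_imp_eq_int)
  moreover have "?f ` ?S = W"
  proof (intro equalityI subsetI)
    fix x assume "x \<in> W"
    then obtain i j k where "x = nf (h * i) (h * j) k" by (rule W_cases)
    also have "\<dots> = nf (h * (i mod (2 * h))) (h * (j mod (2 * h))) (k mod h)"
      by (simp add: nf_eq_iff cong)
    finally show "x \<in> ?f ` ?S"
      using h_pos by (intro image_eqI[of _ _ "(i mod (2 * h), j mod (2 * h), k mod h)"]) auto
  qed (auto intro: nf_in_W)
  ultimately have "card W = card ?S"
    using card_image by fastforce
  also have "int (card ?S) = 2 * h * (2 * h * h)"
    using h_pos by (simp add: card_cartesian_product)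
  also have "\<dots> = int (2 ^ (3 * m - 1))"
  proof -
    have "3 * m - 1 = m + (2 * m - 1)"
      using m by simp
    then have "int (2 ^ (3 * m - 1)) = 2 ^ m * 2 ^ (2 * m - 1)"
      by (simp only: of_nat_power of_nat_numeral of_nat_mult power_add)
    then show ?thesis
      by (simp only: two_power_m two_power_2m1 M_def)
  qed
  finally show ?thesis by simp
qed

end

section \<open>Multiplying the generators by elements of the second centre\<close>

context K_group
begin

lemma Z_closed: "z \<in> Z \<Longrightarrow> z \<in> carrier K"
  using Z_central by blast

lemma Z_commute: "z \<in> Z \<Longrightarrow> g \<in> carrier K \<Longrightarrow> z \<otimes> g = g \<otimes> z"
  using center_commute Z_central by blast

lemma W_closed: "x \<in> W \<Longrightarrow> x \<in> carrier K"
  unfolding W_iff by blast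

lemma Z_pow:
  assumes "z \<in> Z" "h dvd n"
  shows "z [^] n = \<one>"
proof -
  obtain i j where ij: "2 * h dvd i" "2 * h dvd j" "z = a [^] i \<otimes> b [^] j"
    using assms unfolding Z_def by blast
  have "(a [^] i \<otimes> b [^] j) [^] n = (a [^] i) [^] n \<otimes> (b [^] j) [^] n"
    using ij by (intro int_pow_mult_distrib center_commute[OF a_central]) simp_all
  also have "(a [^] i) [^] n = \<one>"
    unfolding int_pow_pow[OF a] M_def
    by (rule int_pow_dvd_eq_one[OF a a_M]) (simp add: M_def ij assms mult_dvd_mono)
  also have "(b [^] j) [^] n = \<one>"
    unfolding int_pow_pow[OF b] M_def
    by (rule int_pow_dvd_eq_one[OF b b_M]) (simp add: M_def ij assms mult_dvd_mono)
  finally show ?thesis by (simp add: ij)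
qed

lemma W_mult:
  assumes "x \<in> W" "g \<in> carrier K"
  obtains w where "w \<in> Z" "x \<otimes> g = g \<otimes> x \<otimes> w"
proof -
  obtain z where z: "z \<in> Z" "x \<otimes> g = z \<otimes> (g \<otimes> x)"
    using assms unfolding W_iff by blast
  have "z \<otimes> (g \<otimes> x) = g \<otimes> x \<otimes> z"
    using assms by (intro Z_commute z) (simp add: W_closed)
  with z show thesis using that by metis
qed

text \<open>The commutator \<open>[x, g]\<close> lies in \<open>Z\<close>, which has exponent \<open>h\<close>.\<close>

lemma W_commute_pow_h:
  assumes "x \<in> W" "g \<in> carrier K"
  shows "x \<otimes> g [^] (h * i) = g [^] (h * i) \<otimes> x"
proof -
  obtain w where w: "w \<in> Z" "x \<otimes> g = g \<otimes> x \<otimes> w"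
    using W_mult assms by blast
  have "x [^] (1::int) \<otimes> g [^] (h * i) = g [^] (h * i) \<otimes> x [^] (1::int) \<otimes> w [^] (1 * (h * i))"
    using assms w by (intro commutator_int_pow Z_commute) (simp_all add: W_closed Z_closed)
  also have "w [^] (1 * (h * i)) = \<one>"
    by (rule Z_pow[OF w(1)]) simp
  finally show ?thesis
    using assms by (simp add: W_closed)
qed

lemma W_conj:
  assumes "x \<in> W" "g \<in> carrier K"
  obtains w where "w \<in> Z" "inv x \<otimes> g \<otimes> x = g \<otimes> w"
proof -
  obtain w where w: "w \<in> Z" "x \<otimes> g = g \<otimes> x \<otimes> w"
    using W_mult assms by blast
  have cl: "x \<in> carrier K" "w \<in> carrier K"
    using assms w by (simp_all add: W_closed Z_closed)
  have "x \<otimes> (g \<otimes> inv w) = (g \<otimes> x \<otimes> w) \<otimes> inv w"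
    unfolding w(2)[symmetric] using cl assms by (simp add: m_assoc)
  also have "\<dots> = g \<otimes> x"
    using cl assms by (simp add: m_assoc)
  finally have "inv x \<otimes> g \<otimes> x = g \<otimes> inv w"
    using cl assms conj_eq_iff[of g "g \<otimes> inv w" x] by simp
  then show thesis
    using that w Z_subgroup by (meson subgroup.m_inv_closed)
qed

text \<open>Conjugation by \<open>x\<close> multiplies \<open>a\<close> and \<open>b\<close> by central elements and so fixes their commutator.\<close>

lemma W_commute_c:
  assumes "x \<in> W"
  shows "x \<otimes> c = c \<otimes> x"
proof -
  obtain w where w: "w \<in> Z" "inv x \<otimes> a \<otimes> x = a \<otimes> w"
    using W_conj[OF assms a] .
  obtain w' where w': "w' \<in> Z" "inv x \<otimes> b \<otimes> x = b \<otimes> w'"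
    using W_conj[OF assms b] .
  have x: "x \<in> carrier K" using assms by (rule W_closed)
  let ?A = "inv x \<otimes> a \<otimes> x" and ?B = "inv x \<otimes> b \<otimes> x"
  have "inv x \<otimes> c \<otimes> x = inv ?A \<otimes> inv ?B \<otimes> ?A \<otimes> ?B"
    unfolding c_def using x by (simp add: inv_mult_group m_assoc mult_inv_cancel)
  also have "\<dots> = c"
    unfolding w(2) w'(2) c_def using w w' Z_central by (intro commutator_mult_central) auto
  finally show ?thesis
    using conj_eq_iff[OF c c x] by simp
qed

text \<open>\<open>W\<close> is generated by \<open>a\<^sup>h\<close>, \<open>b\<^sup>h\<close> and \<open>c\<close>, all of which commute with \<open>W\<close>.\<close>

lemma W_comm:
  assumes "x \<in> W" "y \<in> W"
  shows "x \<otimes> y = y \<otimes> x"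
proof -
  obtain i j k where y: "y = nf (h * i) (h * j) k"
    using assms W_cases by blast
  have "c [^] k \<otimes> x = x \<otimes> c [^] k"
    using W_commute_c[OF assms(1)] assms by (intro int_pow_commute) (simp_all add: W_closed)
  then show ?thesis
    unfolding y nf_def
    using assms by (intro commute_mult W_commute_pow_h) (simp_all add: W_closed)
qed

lemma W_pow:
  assumes "x \<in> W"
  shows "x [^] h \<in> Z" "x [^] (2 * h) = \<one>"
proof -
  obtain i j k where x: "x = nf (h * i) (h * j) k"
    using assms W_cases by blast
  have "a [^] (h * i) = nf (h * i) 0 0" "b [^] (h * j) = nf 0 (h * j) 0"
    by (simp_all add: nf_def)
  then have W: "a [^] (h * i) \<in> W" "b [^] (h * j) \<in> W"
    using nf_in_W by simp_all
  have "c [^] k = nf 0 0 k"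
    by (simp add: nf_def)
  then have ck: "c [^] k \<in> W"
    using nf_in_W by simp
  have pow: "x [^] n = a [^] (h * i * n) \<otimes> b [^] (h * j * n) \<otimes> c [^] (k * n)" for n :: int
  proof -
    have "x [^] n = (a [^] (h * i) \<otimes> b [^] (h * j)) [^] n \<otimes> (c [^] k) [^] n"
      unfolding x nf_def
      by (rule int_pow_mult_distrib, rule commute_mult[symmetric])
        (simp_all add: W_comm W ck)
    also have "(a [^] (h * i) \<otimes> b [^] (h * j)) [^] n = (a [^] (h * i)) [^] n \<otimes> (b [^] (h * j)) [^] n"
      by (rule int_pow_mult_distrib) (simp_all add: W_comm W)
    finally show ?thesis by (simp add: int_pow_pow)
  qed
  have "c [^] (k * h) = \<one>" "c [^] (k * (2 * h)) = \<one>"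
    by (rule int_pow_dvd_eq_one[OF c c_h], simp)+
  moreover have "a [^] (h * i * (2 * h)) = \<one>" "b [^] (h * j * (2 * h)) = \<one>"
    by (rule int_pow_dvd_eq_one[OF a a_M], simp add: M_def)
      (rule int_pow_dvd_eq_one[OF b b_M], simp add: M_def)
  ultimately show "x [^] (2 * h) = \<one>"
    unfolding pow by simp
  have "x [^] h = a [^] (h * i * h) \<otimes> b [^] (h * j * h)"
    unfolding pow \<open>c [^] (k * h) = \<one>\<close> by simp
  moreover have "2 * h dvd h * i * h" for i
    using mult_dvd_mono[OF even_h dvd_refl[of h]] by (simp add: mult.assoc mult.left_commute)
  ultimately show "x [^] h \<in> Z"
    using ZI by blast
qed

lemma W_mult_pow:
  assumes g: "g \<in> carrier K" and x: "x \<in> W"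
  obtains w where "w \<in> Z"
    "\<And>n::nat. (g \<otimes> x) [^] int n = g [^] int n \<otimes> x [^] int n \<otimes> w [^] int (n choose 2)"
proof -
  obtain w where w: "w \<in> Z" "x \<otimes> g = g \<otimes> x \<otimes> w"
    using W_mult x g by blast
  have "(g \<otimes> x) [^] n = g [^] n \<otimes> x [^] n \<otimes> w [^] (n choose 2)" for n :: nat
    using g x w by (intro nat_pow_mult_commutator Z_commute) (simp_all add: W_closed Z_closed)
  then show thesis
    using that[OF w(1)] by (simp add: int_pow_int)
qed

text \<open>The three factors in the collection formula: \<open>x\<^sup>2\<^sup>h = 1\<close>, and \<open>2h choose 2\<close> is a multiple of the exponent \<open>h\<close> of \<open>Z\<close>.\<close>

lemma W_mult_pow_2h:
  assumes g: "g \<in> carrier K" and x: "x \<in> W"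
  shows "(g \<otimes> x) [^] (2 * h) = g [^] (2 * h)"
proof -
  obtain w where w: "w \<in> Z"
    "\<And>n::nat. (g \<otimes> x) [^] int n = g [^] int n \<otimes> x [^] int n \<otimes> w [^] int (n choose 2)"
    using W_mult_pow[OF g x] by blast
  define n where "n = nat (2 * h)"
  have n: "int n = 2 * h" using h_pos by (simp add: n_def)
  have "n choose 2 = nat h * (n - 1)"
    using h_pos by (simp add: choose_two n_def nat_mult_distrib)
  then have "int (n choose 2) = h * int (n - 1)"
    using h_pos by simp
  then have "w [^] int (n choose 2) = \<one>"
    by (intro Z_pow w(1)) simp
  then show ?thesis
    using w(2)[of n] W_pow(2)[OF x] g unfolding n by simp
qed

lemma W_mult_pow_h:
  assumes g: "g \<in> carrier K" and x: "x \<in> W"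
  obtains z where "z \<in> Z" "(g \<otimes> x) [^] h = g [^] h \<otimes> z"
proof -
  obtain w where w: "w \<in> Z"
    "\<And>n::nat. (g \<otimes> x) [^] int n = g [^] int n \<otimes> x [^] int n \<otimes> w [^] int (n choose 2)"
    using W_mult_pow[OF g x] by blast
  define k where "k = int (nat h choose 2)"
  have "(g \<otimes> x) [^] h = g [^] h \<otimes> x [^] h \<otimes> w [^] k"
    using w(2)[of "nat h"] h_pos by (simp add: k_def)
  also have "\<dots> = g [^] h \<otimes> (x [^] h \<otimes> w [^] k)"
    using g x w by (intro m_assoc) (simp_all add: W_closed Z_closed)
  finally have "(g \<otimes> x) [^] h = g [^] h \<otimes> (x [^] h \<otimes> w [^] k)" .
  moreover have "x [^] h \<otimes> w [^] k \<in> Z"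
    using W_pow(1)[OF x] w(1) Z_subgroup
    by (meson subgroup.m_closed subgroup_int_pow_closed)
  ultimately show thesis using that by blast
qed

lemma Z_eq_upper_central: "upper_central K (Suc 0) = Z"
  unfolding upper_central_1 center_eq_Z ..

lemma W_iff_quotient: "x \<in> W \<longleftrightarrow> x \<in> carrier K \<and> Z #> x \<in> center (K Mod Z)"
  unfolding W_def numeral_2_eq_2 upper_central.simps(2)[of K "Suc 0"] Z_eq_upper_central by simp

sublocale Z: normal Z K
  by (rule Z_normal)

sublocale quot: group_hom K "K Mod Z" "\<lambda>g. Z #> g"
  using Z.factorgroup_is_group Z.r_coset_hom_Mod
  by (simp add: group_hom_def group_hom_axioms_def is_group)

text \<open>In \<open>K/Z\<close> the factors \<open>x\<close> and \<open>y\<close> are central.\<close>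

lemma commutator_mult_W:
  assumes x: "x \<in> W" and y: "y \<in> W"
  obtains z where "z \<in> Z" "inv (a \<otimes> x) \<otimes> inv (b \<otimes> y) \<otimes> (a \<otimes> x) \<otimes> (b \<otimes> y) = c \<otimes> z"
proof -
  let ?c = "inv (a \<otimes> x) \<otimes> inv (b \<otimes> y) \<otimes> (a \<otimes> x) \<otimes> (b \<otimes> y)"
  have cl: "x \<in> carrier K" "y \<in> carrier K"
    using x y by (simp_all add: W_closed)
  have "Z #> ?c = Z #> c"
    unfolding c_def
    using quot.H.commutator_mult_central[of "Z #> a" "Z #> b" "Z #> x" "Z #> y"]
      quot.hom_closed cl x y W_iff_quotient
    by (simp del: mult_FactGroup)
  then obtain z where z: "z \<in> Z" "?c = z \<otimes> c"
    using rcos_eq_iff[OF Z_normal, of ?c c] cl by auto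
  then show thesis using that Z_commute[OF z(1) c] by simp
qed

text \<open>As \<open>c\<close> commutes with \<open>x\<close>, conjugating \<open>ax\<close> by \<open>cz\<close> yields \<open>a\<^sup>1\<^sup>+\<^sup>Nx\<close>; and \<open>(ax)\<^sup>N = a\<^sup>N\<close> as \<open>N\<close> is a multiple of \<open>2h\<close>. The
  centre is not called \<open>Z\<close> here so that the lemma can be applied with \<open>a\<close> and \<open>b\<close> exchanged.\<close>

lemma relation_mult_W:
  assumes x: "x \<in> W" and z: "z \<in> center K"
  shows "inv (c \<otimes> z) \<otimes> (a \<otimes> x) \<otimes> (c \<otimes> z) = (a \<otimes> x) [^] (1 + N)"
proof -
  have cl: "x \<in> carrier K" "z \<in> carrier K"
    using x z by (auto simp: W_closed)
  have "(a \<otimes> x) [^] (2 * h * l) = a [^] (2 * h * l)"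
    using W_mult_pow_2h[OF a x] int_pow_pow[of "a \<otimes> x" "2 * h" l] int_pow_pow[of a "2 * h" l] cl by simp
  then have N: "(a \<otimes> x) [^] N = a [^] N" by (simp add: N_def)
  have "inv (c \<otimes> z) \<otimes> (a \<otimes> x) \<otimes> (c \<otimes> z) = inv z \<otimes> (inv c \<otimes> (a \<otimes> x) \<otimes> c \<otimes> z)"
    using cl by (simp add: inv_mult_group m_assoc)
  also have "inv c \<otimes> (a \<otimes> x) \<otimes> c \<otimes> z = z \<otimes> (inv c \<otimes> (a \<otimes> x) \<otimes> c)"
    using center_commute[OF z] cl by simp
  also have "inv z \<otimes> (z \<otimes> (inv c \<otimes> (a \<otimes> x) \<otimes> c)) = inv c \<otimes> (a \<otimes> x) \<otimes> c"
    using cl by (simp add: mult_inv_cancel)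
  also have "\<dots> = inv c \<otimes> a \<otimes> (x \<otimes> c)"
    using cl by (simp add: m_assoc)
  also have "\<dots> = (inv c \<otimes> a \<otimes> c) \<otimes> x"
    unfolding W_commute_c[OF x] using cl by (simp add: m_assoc)
  also have "\<dots> = a \<otimes> (a [^] N \<otimes> x)"
    unfolding c_conj_a using cl by (simp add: int_pow_mult m_assoc)
  also have "a [^] N \<otimes> x = x \<otimes> a [^] N"
    using center_commute[OF a_central[OF N_dvd] cl(1)] .
  also have "a \<otimes> (x \<otimes> a [^] N) = (a \<otimes> x) [^] (1 + N)"
    using cl N by (simp add: int_pow_mult m_assoc)
  finally show ?thesis .
qed

lemma pow_M_mult_W:
  assumes x: "x \<in> W" and g: "g \<in> carrier K" "g [^] M = \<one>"
  shows "(g \<otimes> x) [^] M = \<one>"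
proof -
  have "(g \<otimes> x) [^] M = (g [^] (2 * h)) [^] h"
    unfolding W_mult_pow_2h[OF g(1) x, symmetric] M_def using x g by (simp add: int_pow_pow W_closed)
  also have "\<dots> = \<one>"
    using g by (simp add: int_pow_pow M_def)
  finally show ?thesis .
qed

text \<open>The pair \<open>(ax, by)\<close> satisfies the defining relations of \<open>K\<close>, with \<open>cz\<close> in place of \<open>c\<close>.\<close>

lemma endomorphism_exists:
  assumes x: "x \<in> W" and y: "y \<in> W"
  obtains \<phi> where "\<phi> \<in> hom K K" "\<phi> a = a \<otimes> x" "\<phi> b = b \<otimes> y"
proof -
  have cl: "x \<in> carrier K" "y \<in> carrier K"
    using x y by (simp_all add: W_closed)
  then have cl': "a \<otimes> x \<in> carrier K" "b \<otimes> y \<in> carrier K" by simp_all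
  obtain z where z: "z \<in> Z" "inv (a \<otimes> x) \<otimes> inv (b \<otimes> y) \<otimes> (a \<otimes> x) \<otimes> (b \<otimes> y) = c \<otimes> z"
    using commutator_mult_W[OF x y] .
  have z_cl: "z \<in> carrier K" and z_center: "z \<in> center K" "inv z \<in> center K"
    using z Z_central Z.m_inv_closed by auto
  have "(c \<otimes> z) [^] h = c [^] h \<otimes> z [^] h"
    using Z_commute[OF z(1) c] z_cl by (intro int_pow_mult_distrib) simp_all
  then have ch: "(c \<otimes> z) [^] h = \<one>"
    using z by (simp add: c_h Z_pow)
  have "inv (inv c \<otimes> inv z) \<otimes> (b \<otimes> y) \<otimes> (inv c \<otimes> inv z) = (b \<otimes> y) [^] (1 + N)"
    using K_group.relation_mult_W[OF swap y z_center(2)] unfolding swap_c .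
  moreover have "inv (inv c \<otimes> inv z) = c \<otimes> z"
    using z_cl Z_commute[OF z(1) c] by (simp add: inv_mult_group)
  moreover have "inv c \<otimes> inv z = inv (c \<otimes> z)"
    using z_cl Z_commute[OF z(1) c] by (simp flip: inv_mult_group)
  ultimately have rel_b: "(c \<otimes> z) \<otimes> (b \<otimes> y) \<otimes> inv (c \<otimes> z) = (b \<otimes> y) [^] (1 + N)"
    by simp
  have "\<forall>u v. (u, v) \<in> K_relations m l \<longrightarrow>
      weval K (case_gen (a \<otimes> x) (b \<otimes> y)) u = weval K (case_gen (a \<otimes> x) (b \<otimes> y)) v"
    unfolding K_relations_hold_iff[OF cl', unfolded z(2)] alpha two_power_2m1 h_power
    using relation_mult_W[OF x z_center(1)] rel_b ch pow_M_mult_W[OF x a a_M] pow_M_mult_W[OF y b b_M]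
    by blast
  moreover have "case_gen (a \<otimes> x) (b \<otimes> y) g \<in> carrier K" for g
    using cl' by (simp split: gen.split)
  ultimately obtain \<phi> where \<phi>: "\<phi> \<in> hom K K" "\<And>g. \<phi> (case_gen a b g) = case_gen (a \<otimes> x) (b \<otimes> y) g"
    using presentation_hom_exists[OF presentation is_group] by blast
  from \<phi>(2)[of GenA] \<phi>(2)[of GenB] show thesis
    using that[OF \<phi>(1)] by simp
qed

end

section \<open>Automorphisms acting trivially on a quotient\<close>

lemma AutoGroup_simps:
  "carrier (AutoGroup G) = auto G"
  "\<phi> \<in> auto G \<Longrightarrow> \<psi> \<in> auto G \<Longrightarrow> \<phi> \<otimes>\<^bsub>AutoGroup G\<^esub> \<psi> = compose (carrier G) \<phi> \<psi>"
  "\<one>\<^bsub>AutoGroup G\<^esub> = (\<lambda>x\<in>carrier G. x)"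
  by (simp_all add: AutoGroup_def BijGroup_def auto_def)

lemma auto_closed: "\<phi> \<in> auto G \<Longrightarrow> g \<in> carrier G \<Longrightarrow> \<phi> g \<in> carrier G"
  by (auto simp: auto_def hom_def)

text \<open>Membership of \<open>\<phi>(g)\<close> in the coset of \<open>g\<close> makes \<open>\<phi>\<close> map every coset into itself; it is onto because
  \<open>\<phi>\<close> is, and preimages lie in the same coset.\<close>

lemma (in group) kernel_induced_aut:
  assumes N: "N \<lhd> G"
  shows "kernel (AutoGroup G) (AutoGroup (G Mod N)) (induced_aut G N) =
    {\<phi> \<in> auto G. \<forall>g\<in>carrier G. N #> \<phi> g = N #> g}"
proof -
  interpret N: normal N G by (rule N)
  have "induced_aut G N \<phi> = (\<lambda>C\<in>carrier (G Mod N). C) \<longleftrightarrow> (\<forall>g\<in>carrier G. N #> \<phi> g = N #> g)"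
    if \<phi>: "\<phi> \<in> auto G" for \<phi>
  proof -
    have "induced_aut G N \<phi> = (\<lambda>C\<in>carrier (G Mod N). C) \<longleftrightarrow>
        (\<forall>C\<in>carrier (G Mod N). \<phi> ` C = C)"
      unfolding induced_aut_def by (auto simp: restrict_def fun_eq_iff)
    also have "\<dots> \<longleftrightarrow> (\<forall>g\<in>carrier G. \<phi> ` (N #> g) = N #> g)"
      by (simp add: carrier_FactGroup)
    also have "\<dots> \<longleftrightarrow> (\<forall>g\<in>carrier G. N #> \<phi> g = N #> g)"
    proof
      assume *: "\<forall>g\<in>carrier G. \<phi> ` (N #> g) = N #> g"
      show "\<forall>g\<in>carrier G. N #> \<phi> g = N #> g"
      proof
        fix g assume g: "g \<in> carrier G"
        then have "\<phi> g \<in> N #> g"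
          using * rcos_self[OF g N.subgroup_axioms] by blast
        then show "N #> \<phi> g = N #> g"
          using repr_independence[OF _ g N.subgroup_axioms] by simp
      qed
    next
      assume *: "\<forall>g\<in>carrier G. N #> \<phi> g = N #> g"
      show "\<forall>g\<in>carrier G. \<phi> ` (N #> g) = N #> g"
      proof
        fix g assume g: "g \<in> carrier G"
        have mem: "x \<in> N #> g \<longleftrightarrow> x \<in> carrier G \<and> N #> x = N #> g" for x
          using g repr_independence[OF _ g N.subgroup_axioms, of x] rcos_self[OF _ N.subgroup_axioms, of x]
            r_coset_subset_G[OF N.subset g] by auto
        have surj: "\<phi> ` carrier G = carrier G"
          using \<phi> by (auto simp: auto_def Bij_def bij_betw_def)
        show "\<phi> ` (N #> g) = N #> g"
        proof (intro equalityI subsetI)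
          fix y assume "y \<in> \<phi> ` (N #> g)"
          then obtain x where "x \<in> N #> g" "y = \<phi> x" by blast
          then show "y \<in> N #> g"
            unfolding mem using * auto_closed[OF \<phi>] by simp
        next
          fix y assume y: "y \<in> N #> g"
          then obtain x where "x \<in> carrier G" "y = \<phi> x"
            using surj mem by blast
          then show "y \<in> \<phi> ` (N #> g)"
            using y * unfolding mem by (intro image_eqI[of _ _ x]) (simp_all add: mem)
        qed
      qed
    qed
    finally show ?thesis .
  qed
  then show ?thesis
    unfolding kernel_def AutoGroup_simps by blast
qed

lemma (in group) auto_eqI:
  assumes "\<phi> \<in> auto G" "\<psi> \<in> auto G" and S: "S \<subseteq> carrier G" "generate G S = carrier G"
    and eq: "\<And>s. s \<in> S \<Longrightarrow> \<phi> s = \<psi> s"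
  shows "\<phi> = \<psi>"
proof (rule extensionalityI[of _ "carrier G"])
  show "\<phi> \<in> extensional (carrier G)" "\<psi> \<in> extensional (carrier G)"
    using assms by (auto simp: auto_def Bij_def)
  show "\<phi> g = \<psi> g" if "g \<in> carrier G" for g
    using assms that by (intro homs_eq_on_generators[of G G \<phi> \<psi> S g]) (auto simp: auto_def is_group)
qed

section \<open>The endomorphisms moving the generators by the second centre\<close>

context K_group
begin

lemma W_subgroup: "subgroup W K"
proof (rule subgroupI)
  show "W \<subseteq> carrier K" using W_closed by blast
  have "\<one> = nf (h * 0) (h * 0) 0" by (simp add: nf_def)
  also have "\<dots> \<in> W" by (rule nf_in_W) simp_all
  finally show "W \<noteq> {}" by blast
  have center: "subgroup (center (K Mod Z)) (K Mod Z)"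
    by (rule normal_imp_subgroup[OF quot.H.center_normal])
  show "inv x \<in> W" if "x \<in> W" for x
    using that subgroup.m_inv_closed[OF center, of "Z #> x"] quot.hom_inv[of x]
    unfolding W_iff_quotient by simp
  show "x \<otimes> y \<in> W" if "x \<in> W" "y \<in> W" for x y
    using that subgroup.m_closed[OF center, of "Z #> x" "Z #> y"] quot.hom_mult[of x y]
    unfolding W_iff_quotient by (simp del: mult_FactGroup)
qed

lemma Z_subset_W: "z \<in> Z \<Longrightarrow> z \<in> W"
  unfolding W_iff_quotient
  using Z.rcos_const[OF is_group] Z_closed subgroup.one_closed[OF normal_imp_subgroup[OF quot.H.center_normal]]
  by simp

lemma W_normal: "W \<lhd> K"
proof (rule normal_invI[OF W_subgroup])
  fix g x assume gx: "g \<in> carrier K" "x \<in> W"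
  then obtain w where w: "w \<in> Z" "x \<otimes> inv g = inv g \<otimes> x \<otimes> w"
    using W_mult inv_closed by blast
  have "g \<otimes> x \<otimes> inv g = x \<otimes> w"
    using gx w by (simp add: m_assoc mult_inv_cancel W_closed Z_closed)
  then show "g \<otimes> x \<otimes> inv g \<in> W"
    using gx w Z_subset_W subgroup.m_closed[OF W_subgroup] by simp
qed

sublocale W: normal W K
  by (rule W_normal)

sublocale quotW: group_hom K "K Mod W" "\<lambda>g. W #> g"
  using W.factorgroup_is_group W.r_coset_hom_Mod
  by (simp add: group_hom_def group_hom_axioms_def is_group)

lemma rcos_mult_W: "g \<in> carrier K \<Longrightarrow> x \<in> W \<Longrightarrow> W #> (g \<otimes> x) = W #> g"
  using quotW.hom_mult[of g x] W.rcos_const[OF is_group, of x] quotW.H.r_one[of "W #> g"] quotW.hom_closed[of g]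
    W_closed by (simp del: mult_FactGroup)

lemma rcos_mult_Z: "g \<in> carrier K \<Longrightarrow> z \<in> Z \<Longrightarrow> Z #> (g \<otimes> z) = Z #> g"
  using quot.hom_mult[of g z] Z.rcos_const[OF is_group, of z] quot.H.r_one[of "Z #> g"] quot.hom_closed[of g]
    Z_closed by (simp del: mult_FactGroup)

context
  fixes \<phi> x y
  assumes \<phi>: "\<phi> \<in> hom K K" and x: "x \<in> W" and y: "y \<in> W"
    and \<phi>a: "\<phi> a = a \<otimes> x" and \<phi>b: "\<phi> b = b \<otimes> y"
begin

interpretation phi: group_hom K K \<phi>
  using \<phi> by (simp add: group_hom_def group_hom_axioms_def is_group)

lemma central_endo_mod_W:
  assumes g: "g \<in> carrier K"
  shows "W #> \<phi> g = W #> g"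
proof -
  have "((\<lambda>g. W #> g) \<circ> \<phi>) g = W #> g"
  proof (rule homs_eq_on_generators[OF is_group quotW.H.is_group _ quotW.homh _ generate_ab _ g])
    show "(\<lambda>g. W #> g) \<circ> \<phi> \<in> hom K (K Mod W)"
      by (rule Group.hom_compose[OF \<phi> quotW.homh])
    show "((\<lambda>g. W #> g) \<circ> \<phi>) s = W #> s" if "s \<in> {a, b}" for s
      using that \<phi>a \<phi>b x y rcos_mult_W by auto
  qed auto
  then show ?thesis by simp
qed

lemma central_endo_mod_Z:
  assumes g: "g \<in> carrier K" and "x \<in> Z" "y \<in> Z"
  shows "Z #> \<phi> g = Z #> g"
proof -
  have "((\<lambda>g. Z #> g) \<circ> \<phi>) g = Z #> g"
  proof (rule homs_eq_on_generators[OF is_group quot.H.is_group _ quot.homh _ generate_ab _ g])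
    show "(\<lambda>g. Z #> g) \<circ> \<phi> \<in> hom K (K Mod Z)"
      by (rule Group.hom_compose[OF \<phi> quot.homh])
    show "((\<lambda>g. Z #> g) \<circ> \<phi>) s = Z #> s" if "s \<in> {a, b}" for s
      using that \<phi>a \<phi>b assms rcos_mult_Z by auto
  qed auto
  then show ?thesis by simp
qed

text \<open>\<open>Z\<close> is generated by \<open>a\<^sup>2\<^sup>h\<close> and \<open>b\<^sup>2\<^sup>h\<close>, and \<open>(ax)\<^sup>2\<^sup>h = a\<^sup>2\<^sup>h\<close>.\<close>

lemma central_endo_fixes_Z:
  assumes "z \<in> Z"
  shows "\<phi> z = z"
proof -
  obtain r s where z: "z = a [^] (2 * h * r) \<otimes> b [^] (2 * h * s)"
    using assms unfolding Z_def by (auto elim!: dvdE)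
  have pow: "\<phi> (g [^] (2 * h * i)) = g [^] (2 * h * i)"
    if "g \<in> carrier K" "w \<in> W" "\<phi> g = g \<otimes> w" for g w i
  proof -
    have "\<phi> (g [^] (2 * h * i)) = ((g \<otimes> w) [^] (2 * h)) [^] i"
      using that by (simp add: phi.hom_int_pow int_pow_pow W_closed)
    then show ?thesis
      unfolding W_mult_pow_2h[OF that(1,2)] using that by (simp add: int_pow_pow)
  qed
  show ?thesis
    unfolding z using pow[OF a x \<phi>a] pow[OF b y \<phi>b] by simp
qed

text \<open>It suffices to consider the generators \<open>a\<^sup>h\<close>, \<open>b\<^sup>h\<close> and \<open>c\<close> of \<open>W\<close>.\<close>

lemma central_endo_W_mod_Z:
  assumes "w \<in> W"
  shows "Z #> \<phi> w = Z #> w"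
proof -
  obtain i j k where w: "w = nf (h * i) (h * j) k"
    using assms W_cases by blast
  have pow: "Z #> \<phi> (g [^] (h * i)) = Z #> g [^] (h * i)"
    if g: "g \<in> carrier K" "v \<in> W" "\<phi> g = g \<otimes> v" for g v i
  proof -
    obtain z where z: "z \<in> Z" "(g \<otimes> v) [^] h = g [^] h \<otimes> z"
      using W_mult_pow_h[OF g(1,2)] .
    have "\<phi> (g [^] (h * i)) = ((g \<otimes> v) [^] h) [^] i"
      using that by (simp add: phi.hom_int_pow int_pow_pow W_closed)
    also have "\<dots> = (g [^] h) [^] i \<otimes> z [^] i"
      unfolding z(2) using Z_commute[OF z(1), of "g [^] h"] g z
      by (intro int_pow_mult_distrib) (simp_all add: Z_closed)
    also have "(g [^] h) [^] i = g [^] (h * i)"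
      using g by (simp add: int_pow_pow)
    finally have "\<phi> (g [^] (h * i)) = g [^] (h * i) \<otimes> z [^] i" .
    then show ?thesis
      using rcos_mult_Z[of "g [^] (h * i)" "z [^] i"] g subgroup_int_pow_closed[OF Z_subgroup z(1)] by simp
  qed
  obtain z where z: "z \<in> Z" "inv (a \<otimes> x) \<otimes> inv (b \<otimes> y) \<otimes> (a \<otimes> x) \<otimes> (b \<otimes> y) = c \<otimes> z"
    using commutator_mult_W[OF x y] .
  have "\<phi> c = c \<otimes> z"
    unfolding z(2)[symmetric] by (subst c_def) (simp add: \<phi>a \<phi>b)
  then have "Z #> \<phi> (c [^] k) = Z #> (c \<otimes> z) [^] k"
    by (simp add: phi.hom_int_pow)
  also have "(c \<otimes> z) [^] k = c [^] k \<otimes> z [^] k"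
    using Z_commute[OF z(1) c] z by (intro int_pow_mult_distrib) (simp_all add: Z_closed)
  also have "Z #> (c [^] k \<otimes> z [^] k) = Z #> c [^] k"
    using subgroup_int_pow_closed[OF Z_subgroup z(1)] by (intro rcos_mult_Z) simp_all
  finally have c_pow: "Z #> \<phi> (c [^] k) = Z #> c [^] k" .
  show ?thesis
    unfolding w nf_def using pow[OF a x \<phi>a] pow[OF b y \<phi>b] c_pow
    by (simp add: quot.hom_mult del: mult_FactGroup)
qed

text \<open>The kernel is trivial: an element mapped to 1 lies in \<open>W\<close>, then in \<open>Z\<close>, where \<open>\<phi>\<close> is the identity. The restriction makes the
  map extensional.\<close>

lemma central_endo_auto: "restrict \<phi> (carrier K) \<in> auto K"
proof -
  have "inj_on \<phi> (carrier K)"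
    unfolding inj_on_one_iff'[OF \<phi> is_group is_group]
  proof (intro allI impI)
    fix g assume g: "g \<in> carrier K" and one: "\<phi> g = \<one>"
    have "W #> g = W #> \<one>"
      using central_endo_mod_W[OF g] one by simp
    then have "g \<in> W"
      using rcos_self[OF g W.subgroup_axioms] by (simp add: coset_mult_one W.subset)
    then have "Z #> g = Z #> \<one>"
      using central_endo_W_mod_Z[of g] one by simp
    then have "g \<in> Z"
      using rcos_self[OF g Z.subgroup_axioms] by (simp add: coset_mult_one Z.subset)
    then show "g = \<one>"
      using central_endo_fixes_Z[of g] one by simp
  qed
  moreover from this have "\<phi> ` carrier K = carrier K"
    by (intro endo_inj_surj finite_carrier) auto
  ultimately have "bij_betw \<phi> (carrier K) (carrier K)"
    by (simp add: bij_betw_def)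
  then have "bij_betw (restrict \<phi> (carrier K)) (carrier K) (carrier K)"
    by (subst bij_betw_cong[of _ _ \<phi>]) simp_all
  moreover have "restrict \<phi> (carrier K) \<in> hom K K"
    using \<phi> by (auto simp: hom_def)
  ultimately show ?thesis
    by (simp add: auto_def Bij_def)
qed

end

end

section \<open>The automorphism groups\<close>

context K_group
begin

definition \<Gamma> :: "'a \<times> 'a \<Rightarrow> 'a \<Rightarrow> 'a" where
  "\<Gamma> p = (THE \<phi>. \<phi> \<in> auto K \<and> \<phi> a = a \<otimes> fst p \<and> \<phi> b = b \<otimes> snd p)"

lemma auto_eq_if_eq_on_ab:
  assumes "\<phi> \<in> auto K" "\<psi> \<in> auto K" "\<phi> a = \<psi> a" "\<phi> b = \<psi> b"
  shows "\<phi> = \<psi>"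
  using assms by (intro auto_eqI[OF _ _ _ generate_ab]) auto

lemma
  assumes p: "p \<in> W \<times> W"
  shows \<Gamma>_auto: "\<Gamma> p \<in> auto K" and \<Gamma>_a: "\<Gamma> p a = a \<otimes> fst p" and \<Gamma>_b: "\<Gamma> p b = b \<otimes> snd p"
proof -
  have xy: "fst p \<in> W" "snd p \<in> W" using p by auto
  obtain \<phi> where \<phi>: "\<phi> \<in> hom K K" "\<phi> a = a \<otimes> fst p" "\<phi> b = b \<otimes> snd p"
    using endomorphism_exists[OF xy] .
  have "\<exists>!\<phi>. \<phi> \<in> auto K \<and> \<phi> a = a \<otimes> fst p \<and> \<phi> b = b \<otimes> snd p"
  proof (rule ex1I[of _ "restrict \<phi> (carrier K)"])
    show "restrict \<phi> (carrier K) \<in> auto K \<and> restrict \<phi> (carrier K) a = a \<otimes> fst p \<and>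
        restrict \<phi> (carrier K) b = b \<otimes> snd p"
      using central_endo_auto[OF \<phi>(1) xy \<phi>(2,3)] \<phi>(2,3) by simp
    then show "\<psi> = restrict \<phi> (carrier K)"
      if "\<psi> \<in> auto K \<and> \<psi> a = a \<otimes> fst p \<and> \<psi> b = b \<otimes> snd p" for \<psi>
      using that by (intro auto_eq_if_eq_on_ab) auto
  qed
  from theI'[OF this] show "\<Gamma> p \<in> auto K" "\<Gamma> p a = a \<otimes> fst p" "\<Gamma> p b = b \<otimes> snd p"
    unfolding \<Gamma>_def by blast+
qed

lemma auto_hom: "\<phi> \<in> auto K \<Longrightarrow> \<phi> \<in> hom K K"
  by (simp add: auto_def)

lemma
  assumes p: "p \<in> W \<times> W"
  shows \<Gamma>_mod_W: "g \<in> carrier K \<Longrightarrow> W #> \<Gamma> p g = W #> g"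
    and \<Gamma>_fixes_Z: "z \<in> Z \<Longrightarrow> \<Gamma> p z = z"
    and \<Gamma>_W_mod_Z: "w \<in> W \<Longrightarrow> Z #> \<Gamma> p w = Z #> w"
    and \<Gamma>_mod_Z: "p \<in> Z \<times> Z \<Longrightarrow> g \<in> carrier K \<Longrightarrow> Z #> \<Gamma> p g = Z #> g"
proof -
  have xy: "fst p \<in> W" "snd p \<in> W" using p by auto
  note \<Gamma> = auto_hom[OF \<Gamma>_auto[OF p]] xy \<Gamma>_a[OF p] \<Gamma>_b[OF p]
  show "g \<in> carrier K \<Longrightarrow> W #> \<Gamma> p g = W #> g"
    by (rule central_endo_mod_W[OF \<Gamma>])
  show "z \<in> Z \<Longrightarrow> \<Gamma> p z = z"
    by (rule central_endo_fixes_Z[OF \<Gamma>])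
  show "w \<in> W \<Longrightarrow> Z #> \<Gamma> p w = Z #> w"
    by (rule central_endo_W_mod_Z[OF \<Gamma>])
  show "p \<in> Z \<times> Z \<Longrightarrow> g \<in> carrier K \<Longrightarrow> Z #> \<Gamma> p g = Z #> g"
    using central_endo_mod_Z[OF \<Gamma>] by (simp add: mem_Times_iff)
qed

lemma central_auts_1: "central_auts 1 K = {\<phi> \<in> auto K. \<forall>g\<in>carrier K. Z #> \<phi> g = Z #> g}"
  unfolding central_auts_def One_nat_def Z_eq_upper_central by (rule kernel_induced_aut[OF Z_normal])

lemma central_auts_2: "central_auts 2 K = {\<phi> \<in> auto K. \<forall>g\<in>carrier K. W #> \<phi> g = W #> g}"
  unfolding central_auts_def W_def[symmetric] by (rule kernel_induced_aut[OF W_normal])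

lemma \<Gamma>_in_Aut2: "p \<in> W \<times> W \<Longrightarrow> \<Gamma> p \<in> central_auts 2 K"
  unfolding central_auts_2 using \<Gamma>_auto \<Gamma>_mod_W by blast

lemma Aut2_eq_\<Gamma>:
  assumes \<phi>: "\<phi> \<in> central_auts 2 K"
  shows "(inv a \<otimes> \<phi> a, inv b \<otimes> \<phi> b) \<in> W \<times> W" "\<phi> = \<Gamma> (inv a \<otimes> \<phi> a, inv b \<otimes> \<phi> b)"
proof -
  have auto: "\<phi> \<in> auto K" and W: "\<And>g. g \<in> carrier K \<Longrightarrow> W #> \<phi> g = W #> g"
    using \<phi> unfolding central_auts_2 by auto
  show p: "(inv a \<otimes> \<phi> a, inv b \<otimes> \<phi> b) \<in> W \<times> W"
    using rcos_eq_imp_inv_mult_mem[OF W_normal _ _ W] auto_closed[OF auto] by simp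
  show "\<phi> = \<Gamma> (inv a \<otimes> \<phi> a, inv b \<otimes> \<phi> b)"
    using auto_eq_if_eq_on_ab[OF auto \<Gamma>_auto[OF p]] \<Gamma>_a[OF p] \<Gamma>_b[OF p] auto_closed[OF auto]
    by (simp add: mult_inv_cancel)
qed

lemma \<Gamma>_in_Aut1_iff:
  assumes p: "p \<in> W \<times> W"
  shows "\<Gamma> p \<in> central_auts 1 K \<longleftrightarrow> p \<in> Z \<times> Z"
proof
  assume "\<Gamma> p \<in> central_auts 1 K"
  then have Z: "\<And>g. g \<in> carrier K \<Longrightarrow> Z #> \<Gamma> p g = Z #> g"
    unfolding central_auts_1 by auto
  have "inv g \<otimes> \<Gamma> p g \<in> Z" if "g \<in> carrier K" for g
    using rcos_eq_imp_inv_mult_mem[OF Z_normal that auto_closed[OF \<Gamma>_auto[OF p] that] Z[OF that]] .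
  from this[OF a] this[OF b] show "p \<in> Z \<times> Z"
    using p by (auto simp: \<Gamma>_a \<Gamma>_b mult_inv_cancel W_closed)
next
  assume "p \<in> Z \<times> Z"
  then show "\<Gamma> p \<in> central_auts 1 K"
    unfolding central_auts_1 using \<Gamma>_auto[OF p] \<Gamma>_mod_Z[OF p] by blast
qed

lemma card_Aut2: "card (central_auts 2 K) = 2 ^ (6 * m - 2)"
proof -
  have "inj_on \<Gamma> (W \<times> W)"
  proof (rule inj_onI)
    fix p q assume pq: "p \<in> W \<times> W" "q \<in> W \<times> W" and eq: "\<Gamma> p = \<Gamma> q"
    have "a \<otimes> fst p = a \<otimes> fst q" "b \<otimes> snd p = b \<otimes> snd q"
      using \<Gamma>_a[OF pq(1)] \<Gamma>_a[OF pq(2)] \<Gamma>_b[OF pq(1)] \<Gamma>_b[OF pq(2)] eq by simp_all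
    then show "p = q"
      using pq by (auto simp: W_closed)
  qed
  moreover have "\<Gamma> ` (W \<times> W) = central_auts 2 K"
    using \<Gamma>_in_Aut2 Aut2_eq_\<Gamma> by blast
  ultimately have "card (central_auts 2 K) = card (W \<times> W)"
    using card_image by fastforce
  also have "\<dots> = 2 ^ ((3 * m - 1) + (3 * m - 1))"
    by (simp only: card_cartesian_product card_W power_add)
  also have "(3 * m - 1) + (3 * m - 1) = 6 * m - 2"
    using m by simp
  finally show ?thesis .
qed

end

context K_group
begin

abbreviation Z2K where "Z2K \<equiv> K\<lparr>carrier := W\<rparr>"
abbreviation Aut2K where "Aut2K \<equiv> (AutoGroup K)\<lparr>carrier := central_auts 2 K\<rparr>"

lemma Aut2_subgroup: "subgroup (central_auts 2 K) (AutoGroup K)"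
proof (rule group.subgroupI[OF AutoGroup])
  interpret Aut: group "AutoGroup K" by (rule AutoGroup)
  show "central_auts 2 K \<subseteq> carrier (AutoGroup K)"
    unfolding central_auts_2 AutoGroup_simps by blast
  have "(\<one>, \<one>) \<in> W \<times> W" using subgroup.one_closed[OF W_subgroup] by simp
  from \<Gamma>_in_Aut2[OF this] show "central_auts 2 K \<noteq> {}" by blast
  fix \<phi> assume \<phi>: "\<phi> \<in> central_auts 2 K"
  then have auto: "\<phi> \<in> auto K" and W: "\<And>g. g \<in> carrier K \<Longrightarrow> W #> \<phi> g = W #> g"
    unfolding central_auts_2 by auto
  define \<psi> where "\<psi> = inv\<^bsub>AutoGroup K\<^esub> \<phi>"
  have \<psi>: "\<psi> \<in> auto K"
    using Aut.inv_closed auto unfolding \<psi>_def AutoGroup_simps by blast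
  have "\<phi> \<otimes>\<^bsub>AutoGroup K\<^esub> \<psi> = \<one>\<^bsub>AutoGroup K\<^esub>"
    using Aut.r_inv auto unfolding \<psi>_def AutoGroup_simps(1) by blast
  then have "compose (carrier K) \<phi> \<psi> = (\<lambda>x\<in>carrier K. x)"
    by (simp only: AutoGroup_simps(2)[OF auto \<psi>] AutoGroup_simps(3))
  then have eq: "\<phi> (\<psi> g) = g" if "g \<in> carrier K" for g
    using that by (metis compose_eq restrict_apply')
  have "W #> \<psi> g = W #> g" if "g \<in> carrier K" for g
    using W[OF auto_closed[OF \<psi> that]] eq[OF that] by simp
  then show "inv\<^bsub>AutoGroup K\<^esub> \<phi> \<in> central_auts 2 K"
    using \<psi> unfolding central_auts_2 \<psi>_def by blast
  fix \<chi> assume "\<chi> \<in> central_auts 2 K"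
  then have \<chi>: "\<chi> \<in> auto K" "\<And>g. g \<in> carrier K \<Longrightarrow> W #> \<chi> g = W #> g"
    unfolding central_auts_2 by auto
  have "\<phi> \<otimes>\<^bsub>AutoGroup K\<^esub> \<chi> \<in> auto K"
    using Aut.m_closed auto \<chi> unfolding AutoGroup_simps(1) by blast
  then show "\<phi> \<otimes>\<^bsub>AutoGroup K\<^esub> \<chi> \<in> central_auts 2 K"
    unfolding central_auts_2 AutoGroup_simps(2)[OF auto \<chi>(1)]
    using W \<chi> auto_closed[OF \<chi>(1)] by (simp add: compose_eq)
qed

lemma group_Aut2K: "group Aut2K"
  by (rule group.subgroup_imp_group[OF AutoGroup Aut2_subgroup])

lemma Z_normal_Z2K: "Z \<lhd> Z2K"
  using Z_subset_W by (intro normal_restrict_supergroup W_subgroup Z_normal subsetI)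

lemma rcos_Z2K: "Z #>\<^bsub>Z2K\<^esub> x = Z #> x"
  by (simp add: r_coset_def)

lemma carrier_Z2K_Mod_Z: "carrier (Z2K Mod Z) = (\<lambda>x. Z #> x) ` W"
  by (simp add: carrier_FactGroup rcos_Z2K)

lemma mult_Z2K_Mod_Z:
  assumes "x \<in> W" "y \<in> W"
  shows "(Z #> x) \<otimes>\<^bsub>Z2K Mod Z\<^esub> (Z #> y) = Z #> (x \<otimes> y)"
  using normal.rcos_sum[OF Z_normal_Z2K, of x y] assms by (simp add: rcos_Z2K)

text \<open>The map that induces the isomorphism of the quotient with \<open>(W/Z)\<^sup>2\<close>. In terms of the parameters it
  is reduction modulo \<open>Z\<close> (\<open>\<theta>_\<Gamma>\<close>), but this form is defined without choosing them.\<close>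

definition \<theta> where "\<theta> \<phi> = (Z #> (inv a \<otimes> \<phi> a), Z #> (inv b \<otimes> \<phi> b))"

lemma \<theta>_\<Gamma>: "p \<in> W \<times> W \<Longrightarrow> \<theta> (\<Gamma> p) = (Z #> fst p, Z #> snd p)"
  by (auto simp: \<theta>_def \<Gamma>_a \<Gamma>_b mult_inv_cancel W_closed)

text \<open>\<open>\<Gamma> p\<close> maps \<open>ax'\<close> to \<open>ax (\<Gamma> p x')\<close>, and \<open>\<Gamma> p x'\<close> is congruent to \<open>x'\<close> modulo \<open>Z\<close>. Note that \<open>\<Gamma>\<close> itself
  is not claimed to be multiplicative.\<close>

lemma \<theta>_mult:
  assumes p: "p \<in> W \<times> W" and q: "q \<in> W \<times> W"
  shows "\<theta> (\<Gamma> p \<otimes>\<^bsub>AutoGroup K\<^esub> \<Gamma> q) = (Z #> (fst p \<otimes> fst q), Z #> (snd p \<otimes> snd q))"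
proof -
  have hom: "\<Gamma> p (u \<otimes> v) = \<Gamma> p u \<otimes> \<Gamma> p v" if "u \<in> carrier K" "v \<in> carrier K" for u v
    using auto_hom[OF \<Gamma>_auto[OF p]] that by (rule hom_mult)
  have "Z #> (inv g \<otimes> \<Gamma> p (g \<otimes> y)) = Z #> (x \<otimes> y)"
    if "g \<in> carrier K" "x \<in> W" "y \<in> W" "\<Gamma> p g = g \<otimes> x" for g x y
  proof -
    have cl: "x \<in> carrier K" "y \<in> carrier K" "\<Gamma> p y \<in> carrier K"
      using that W_closed auto_closed[OF \<Gamma>_auto[OF p]] by auto
    have "inv g \<otimes> \<Gamma> p (g \<otimes> y) = x \<otimes> \<Gamma> p y"
      using that cl by (simp add: hom m_assoc mult_inv_cancel)
    then show ?thesis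
      using \<Gamma>_W_mod_Z[OF p that(3)] quot.hom_mult[of x "\<Gamma> p y"] quot.hom_mult[of x y] cl by simp
  qed
  from this[OF a _ _ \<Gamma>_a[OF p]] this[OF b _ _ \<Gamma>_b[OF p]] show ?thesis
    using p q unfolding \<theta>_def AutoGroup_simps(2)[OF \<Gamma>_auto[OF p] \<Gamma>_auto[OF q]]
    by (simp add: compose_eq \<Gamma>_a[OF q] \<Gamma>_b[OF q] mem_Times_iff)
qed

lemma \<theta>_group_hom: "group_hom Aut2K ((Z2K Mod Z) \<times>\<times> (Z2K Mod Z)) \<theta>"
proof (intro group_hom.intro group_hom_axioms.intro group_Aut2K DirProd_group
    normal.factorgroup_is_group[OF Z_normal_Z2K] homI)
  fix \<phi> assume "\<phi> \<in> carrier Aut2K"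
  then have \<phi>: "\<phi> \<in> central_auts 2 K" by simp
  obtain p where p: "p \<in> W \<times> W" "\<phi> = \<Gamma> p"
    using Aut2_eq_\<Gamma>[OF \<phi>] by blast
  show "\<theta> \<phi> \<in> carrier ((Z2K Mod Z) \<times>\<times> (Z2K Mod Z))"
    unfolding p(2) \<theta>_\<Gamma>[OF p(1)] using p(1) by (auto simp: carrier_Z2K_Mod_Z)
  fix \<psi> assume "\<psi> \<in> carrier Aut2K"
  then have \<psi>: "\<psi> \<in> central_auts 2 K" by simp
  obtain q where q: "q \<in> W \<times> W" "\<psi> = \<Gamma> q"
    using Aut2_eq_\<Gamma>[OF \<psi>] by blast
  have "fst p \<in> W" "fst q \<in> W" "snd p \<in> W" "snd q \<in> W"
    using p(1) q(1) by auto
  then have "\<theta> (\<phi> \<otimes>\<^bsub>AutoGroup K\<^esub> \<psi>) = \<theta> \<phi> \<otimes>\<^bsub>(Z2K Mod Z) \<times>\<times> (Z2K Mod Z)\<^esub> \<theta> \<psi>"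
    by (simp only: p(2) q(2) \<theta>_mult[OF p(1) q(1)] \<theta>_\<Gamma>[OF p(1)] \<theta>_\<Gamma>[OF q(1)] mult_DirProd
        mult_Z2K_Mod_Z)
  then show "\<theta> (\<phi> \<otimes>\<^bsub>Aut2K\<^esub> \<psi>) = \<theta> \<phi> \<otimes>\<^bsub>(Z2K Mod Z) \<times>\<times> (Z2K Mod Z)\<^esub> \<theta> \<psi>"
    by simp
qed

sublocale theta: group_hom Aut2K "(Z2K Mod Z) \<times>\<times> (Z2K Mod Z)" \<theta>
  by (rule \<theta>_group_hom)

lemma rcos_Z_eq_Z_iff: "x \<in> carrier K \<Longrightarrow> Z #> x = Z \<longleftrightarrow> x \<in> Z"
  using rcos_self[OF _ Z_subgroup] Z.rcos_const[OF is_group] by blast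

lemma kernel_\<theta>: "kernel Aut2K ((Z2K Mod Z) \<times>\<times> (Z2K Mod Z)) \<theta> = central_auts 1 K"
proof -
  have "central_auts 1 K \<subseteq> central_auts 2 K"
  proof
    fix \<phi> assume \<phi>: "\<phi> \<in> central_auts 1 K"
    then have auto: "\<phi> \<in> auto K" and Z: "\<And>g. g \<in> carrier K \<Longrightarrow> Z #> \<phi> g = Z #> g"
      unfolding central_auts_1 by auto
    have "W #> \<phi> g = W #> g" if g: "g \<in> carrier K" for g
      using Z[OF g] g auto_closed[OF auto g] rcos_eq_iff[OF Z_normal, of "\<phi> g" g]
        rcos_eq_iff[OF W_normal, of "\<phi> g" g] Z_subset_W by blast
    then show "\<phi> \<in> central_auts 2 K"
      using auto unfolding central_auts_2 by blast
  qed
  moreover have "\<theta> \<phi> = \<one>\<^bsub>(Z2K Mod Z) \<times>\<times> (Z2K Mod Z)\<^esub> \<longleftrightarrow> \<phi> \<in> central_auts 1 K"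
    if \<phi>: "\<phi> \<in> central_auts 2 K" for \<phi>
  proof -
    obtain p where p: "p \<in> W \<times> W" "\<phi> = \<Gamma> p"
      using Aut2_eq_\<Gamma>[OF \<phi>] by blast
    have "fst p \<in> carrier K" "snd p \<in> carrier K"
      using p(1) W_closed by auto
    then show ?thesis
      unfolding p(2) \<Gamma>_in_Aut1_iff[OF p(1)] \<theta>_\<Gamma>[OF p(1)]
      by (simp add: rcos_Z_eq_Z_iff mem_Times_iff)
  qed
  ultimately show ?thesis
    unfolding kernel_def by auto
qed

lemma \<theta>_surj: "\<theta> ` carrier Aut2K = carrier ((Z2K Mod Z) \<times>\<times> (Z2K Mod Z))"
proof
  show "carrier ((Z2K Mod Z) \<times>\<times> (Z2K Mod Z)) \<subseteq> \<theta> ` carrier Aut2K"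
  proof
    fix C assume "C \<in> carrier ((Z2K Mod Z) \<times>\<times> (Z2K Mod Z))"
    then obtain x y where xy: "x \<in> W" "y \<in> W" "C = (Z #> x, Z #> y)"
      by (auto simp: carrier_Z2K_Mod_Z)
    then have "C = \<theta> (\<Gamma> (x, y))" by (simp add: \<theta>_\<Gamma>)
    then show "C \<in> \<theta> ` carrier Aut2K"
      using xy \<Gamma>_in_Aut2[of "(x, y)"] by auto
  qed
qed (use theta.hom_closed in blast)

lemma Aut2_Mod_Aut1_iso: "Aut2K Mod central_auts 1 K \<cong> (Z2K Mod Z) \<times>\<times> (Z2K Mod Z)"
  using theta.FactGroup_iso[OF \<theta>_surj] unfolding kernel_\<theta> .

lemma Aut1_normal: "central_auts 1 K \<lhd> Aut2K"
  using theta.normal_kernel unfolding kernel_\<theta> .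

lemma lcos_\<Gamma>:
  assumes "p \<in> W \<times> W"
  shows "\<Gamma> p <#\<^bsub>Aut2K\<^esub> central_auts 1 K = central_auts 1 K #>\<^bsub>Aut2K\<^esub> \<Gamma> p"
  using normal.coset_eq[OF Aut1_normal] \<Gamma>_in_Aut2[OF assms] by simp

text \<open>Two elements lie in the same coset of the kernel of \<open>\<theta>\<close> if and only if \<open>\<theta>\<close> agrees on them, and \<open>\<theta>\<close> has the same
  value on \<open>\<Gamma> (pq)\<close> and on the product of \<open>\<Gamma> p\<close> and \<open>\<Gamma> q\<close>.\<close>

lemma coset_\<Gamma>_epi:
  "(\<lambda>p. \<Gamma> p <#\<^bsub>Aut2K\<^esub> central_auts 1 K) \<in> epi (Z2K \<times>\<times> Z2K) (Aut2K Mod central_auts 1 K)"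
  unfolding epi_def
proof (intro CollectI conjI homI)
  let ?g = "\<lambda>p. \<Gamma> p <#\<^bsub>Aut2K\<^esub> central_auts 1 K"
  show cl: "?g p \<in> carrier (Aut2K Mod central_auts 1 K)" if "p \<in> carrier (Z2K \<times>\<times> Z2K)" for p
    using that \<Gamma>_in_Aut2 lcos_\<Gamma> by (auto simp: carrier_FactGroup)
  show "?g (p \<otimes>\<^bsub>Z2K \<times>\<times> Z2K\<^esub> q) = ?g p \<otimes>\<^bsub>Aut2K Mod central_auts 1 K\<^esub> ?g q"
    if "p \<in> carrier (Z2K \<times>\<times> Z2K)" "q \<in> carrier (Z2K \<times>\<times> Z2K)" for p q
  proof -
    have p: "p \<in> W \<times> W" and q: "q \<in> W \<times> W" using that by simp_all
    define r where "r = (fst p \<otimes> fst q, snd p \<otimes> snd q)"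
    have r: "r \<in> W \<times> W"
      using p q subgroup.m_closed[OF W_subgroup] by (auto simp: r_def)
    have pq: "p \<otimes>\<^bsub>Z2K \<times>\<times> Z2K\<^esub> q = r"
      by (simp add: r_def mult_DirProd')
    have \<Gamma>: "\<Gamma> p \<in> carrier Aut2K" "\<Gamma> q \<in> carrier Aut2K" "\<Gamma> r \<in> carrier Aut2K"
      using \<Gamma>_in_Aut2 p q r by simp_all
    have "\<theta> (\<Gamma> r) = \<theta> (\<Gamma> p \<otimes>\<^bsub>Aut2K\<^esub> \<Gamma> q)"
      using \<theta>_mult[OF p q] \<theta>_\<Gamma>[OF r] by (simp add: r_def)
    then have "central_auts 1 K #>\<^bsub>Aut2K\<^esub> \<Gamma> r = central_auts 1 K #>\<^bsub>Aut2K\<^esub> (\<Gamma> p \<otimes>\<^bsub>Aut2K\<^esub> \<Gamma> q)"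
      using theta.rcos_kernel_eq_iff[OF \<Gamma>(3) theta.G.m_closed[OF \<Gamma>(1,2)]] unfolding kernel_\<theta> by simp
    also have "\<dots> = (central_auts 1 K #>\<^bsub>Aut2K\<^esub> \<Gamma> p) \<otimes>\<^bsub>Aut2K Mod central_auts 1 K\<^esub>
        (central_auts 1 K #>\<^bsub>Aut2K\<^esub> \<Gamma> q)"
      using normal.rcos_sum[OF Aut1_normal \<Gamma>(1,2)] by simp
    finally show ?thesis
      unfolding pq lcos_\<Gamma>[OF p] lcos_\<Gamma>[OF q] lcos_\<Gamma>[OF r] .
  qed
  show "?g ` carrier (Z2K \<times>\<times> Z2K) = carrier (Aut2K Mod central_auts 1 K)"
  proof
    show "?g ` carrier (Z2K \<times>\<times> Z2K) \<subseteq> carrier (Aut2K Mod central_auts 1 K)"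
      using cl by blast
    show "carrier (Aut2K Mod central_auts 1 K) \<subseteq> ?g ` carrier (Z2K \<times>\<times> Z2K)"
    proof
      fix C assume "C \<in> carrier (Aut2K Mod central_auts 1 K)"
      then obtain \<phi> where \<phi>: "\<phi> \<in> central_auts 2 K" "C = central_auts 1 K #>\<^bsub>Aut2K\<^esub> \<phi>"
        by (auto simp: carrier_FactGroup)
      obtain p where p: "p \<in> W \<times> W" "\<phi> = \<Gamma> p"
        using Aut2_eq_\<Gamma>[OF \<phi>(1)] by blast
      then have "C = ?g p"
        using \<phi>(2) lcos_\<Gamma>[OF p(1)] by simp
      then show "C \<in> ?g ` carrier (Z2K \<times>\<times> Z2K)"
        using p(1) by simp
    qed
  qed
qed

lemma coset_\<Gamma>_kernel:
  "kernel (Z2K \<times>\<times> Z2K) (Aut2K Mod central_auts 1 K) (\<lambda>p. \<Gamma> p <#\<^bsub>Aut2K\<^esub> central_auts 1 K) = Z \<times> Z"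
proof -
  have "\<Gamma> p <#\<^bsub>Aut2K\<^esub> central_auts 1 K = central_auts 1 K \<longleftrightarrow> p \<in> Z \<times> Z" if p: "p \<in> W \<times> W" for p
  proof -
    have "\<Gamma> p \<in> carrier Aut2K" using \<Gamma>_in_Aut2[OF p] by simp
    then have "central_auts 1 K #>\<^bsub>Aut2K\<^esub> \<Gamma> p = central_auts 1 K \<longleftrightarrow> \<Gamma> p \<in> central_auts 1 K"
      using theta.G.rcos_self[OF _ normal_imp_subgroup[OF Aut1_normal]]
        subgroup.rcos_const[OF normal_imp_subgroup[OF Aut1_normal] group_Aut2K] by blast
    then show ?thesis
      using \<Gamma>_in_Aut1_iff[OF p] lcos_\<Gamma>[OF p] by simp
  qed
  then show ?thesis
    unfolding kernel_def using Z_subset_W by auto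
qed

text \<open>The coset is mapped into itself; as it is finite and \<open>\<Gamma> p\<close> is injective, it is mapped onto itself.\<close>

lemma \<Gamma>_image_coset:
  assumes p: "p \<in> W \<times> W" and C: "C \<in> carrier (Z2K Mod Z)"
  shows "\<Gamma> p ` C = C"
proof -
  obtain w where w: "w \<in> W" "C = Z #> w"
    using C by (auto simp: carrier_Z2K_Mod_Z)
  have sub: "C \<subseteq> carrier K"
    unfolding w using r_coset_subset_G[OF Z.subset] W_closed w by blast
  have "\<Gamma> p ` C \<subseteq> C"
  proof
    fix v assume "v \<in> \<Gamma> p ` C"
    then obtain z where z: "z \<in> Z" "v = \<Gamma> p (z \<otimes> w)"
      unfolding w by (auto simp: r_coset_def)
    have zw: "z \<otimes> w \<in> W"
      using z w Z_subset_W subgroup.m_closed[OF W_subgroup] by blast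
    have "Z #> v = Z #> (z \<otimes> w)"
      unfolding z(2) by (rule \<Gamma>_W_mod_Z[OF p zw])
    also have "\<dots> = Z #> w"
      using rcos_eq_iff[OF Z_normal] z w zw W_closed by blast
    finally have "Z #> v = C" using w by simp
    then show "v \<in> C"
      using rcos_self[OF _ Z_subgroup, of v] auto_closed[OF \<Gamma>_auto[OF p] W_closed[OF zw]] z by auto
  qed
  moreover have "inj_on (\<Gamma> p) C"
    using \<Gamma>_auto[OF p] sub by (auto simp: auto_def Bij_def bij_betw_def intro: inj_on_subset)
  moreover have "finite C"
    using sub finite_carrier by (rule finite_subset)
  ultimately show ?thesis
    by (intro endo_inj_surj)
qed

end

theorem proposition5p9:
  fixes m :: nat and l :: int and K :: "('a, 'b) monoid_scheme" and a b :: 'a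
  assumes "m > 1" and "odd l" and "is_K m l K a b"
  defines "Z1 \<equiv> upper_central K 1"
    and "Z2 \<equiv> upper_central K 2"
    and "Aut1 \<equiv> central_auts 1 K"
    and "Aut2 \<equiv> central_auts 2 K"
  defines "Z2K \<equiv> K\<lparr>carrier := Z2\<rparr>"
    and "Aut2K \<equiv> (AutoGroup K)\<lparr>carrier := Aut2\<rparr>"
  shows "\<exists>\<Gamma>.
    (\<forall>x\<in>Z2. \<forall>y\<in>Z2.
        \<Gamma> (x, y) \<in> Aut2 \<and> \<Gamma> (x, y) a = a \<otimes>\<^bsub>K\<^esub> x \<and> \<Gamma> (x, y) b = b \<otimes>\<^bsub>K\<^esub> y \<and>
        (\<forall>z\<in>Z1. \<Gamma> (x, y) z = z) \<and>
        (\<forall>C\<in>carrier (Z2K Mod Z1). \<Gamma> (x, y) ` C = C)) \<and>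
    card Aut2 = 2 ^ (6 * m - 2) \<and>
    (let g = (\<lambda>p. \<Gamma> p <#\<^bsub>Aut2K\<^esub> Aut1) in
        g \<in> epi (Z2K \<times>\<times> Z2K) (Aut2K Mod Aut1) \<and>
        kernel (Z2K \<times>\<times> Z2K) (Aut2K Mod Aut1) g = Z1 \<times> Z1) \<and>
    Aut2K Mod Aut1 \<cong> (Z2K Mod Z1) \<times>\<times> (Z2K Mod Z1)"
proof -
  have "group K"
    using assms(3) by (simp add: is_K_def has_presentation_def)
  then interpret K_group K a b m l
    using assms(1-3) by (intro K_group.intro K_group_axioms.intro parameters.intro)
  have Z1: "Z1 = Z" and Z2: "Z2 = W"
    by (simp_all only: Z1_def Z2_def One_nat_def W_def Z_eq_upper_central)
  show ?thesis
    unfolding Z2K_def Aut2K_def Aut1_def Aut2_def Z1 Z2 Let_def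
    using \<Gamma>_in_Aut2 \<Gamma>_a \<Gamma>_b \<Gamma>_fixes_Z \<Gamma>_image_coset card_Aut2 coset_\<Gamma>_epi coset_\<Gamma>_kernel
      Aut2_Mod_Aut1_iso
    by (intro exI[of _ \<Gamma>]) simp
qed

end
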